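(* Let $E$ be a Hermite–Biehler entire function with no real zeros whose phase function satisfies $\varphi'\in L^\infty(\mathbb{R})$, and let $0<p<\infty$. Then $$C(p,E)\le\frac{\lVert\varphi'\rVert_\infty^{1/p}}{2^{1/p}K(p)},\qquad\text{where } K(p)=\left(\int_{-\pi/2}^{\pi/2}\lvert\cos x\rvert^p\,dx\right)^{1/p}.$$
   Context: An entire function $E$ is Hermite–Biehler if $\lvert E(\overline{z})\rvert < \lvert E(z)\rvert$ for $z$ in the upper half-plane $\mathbb{C}_+$. Let $E^{\#}(z)=\overline{E(\overline z)}$; the phase function $\varphi$ is a smooth real function on $\mathbb{R}$ with $E^{\#}(x)/E(x)=e^{i\varphi(x)}$. For $0<p<\infty$, $\mathcal{H}^p(E)$ is the space of entire $f$ with $f/E, f^{\#}/E$ in the Hardy space $H^p(\mathbb{C}_+)$, $\lVert f/E\rVert_p=(\int_{\mathbb{R}}\lvert f/E\rvert^p dx)^{1/p}$; $\mathcal{H}^\infty(E)$ is defined with bounded analytic functions and $\lVert f/E\rVert_\infty=\sup_{\mathbb{R}}\lvert f/E\rvert$. When $\varphi'\in L^\infty$, $\mathcal{H}^p(E)\subset\mathcal{H}^\infty(E)$ and $C(p,E)$ is the norm of this embedding. *)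

theory Defs
  imports "HOL-Analysis.Analysis"
begin

definition upper_half_plane :: "complex set" where
  "upper_half_plane = {z. Im z > 0}"

definition hermite_biehler :: "(complex \<Rightarrow> complex) \<Rightarrow> bool" where
  "hermite_biehler E \<longleftrightarrow> E holomorphic_on UNIV \<and>
     (\<forall>z. Im z > 0 \<longrightarrow> cmod (E (cnj z)) < cmod (E z))"

definition sharp :: "(complex \<Rightarrow> complex) \<Rightarrow> complex \<Rightarrow> complex" where
  "sharp E z = cnj (E (cnj z))"

definition smooth_real :: "(real \<Rightarrow> real) \<Rightarrow> bool" where
  "smooth_real \<phi> \<longleftrightarrow> (\<forall>n x. ((deriv ^^ n) \<phi>) differentiable (at x))"

definition phase_function :: "(complex \<Rightarrow> complex) \<Rightarrow> (real \<Rightarrow> real) \<Rightarrow> bool" where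
  "phase_function E \<phi> \<longleftrightarrow> smooth_real \<phi> \<and>
     (\<forall>x::real. sharp E (of_real x) / E (of_real x) = exp (\<i> * of_real (\<phi> x)))"

definition hardy :: "real \<Rightarrow> (complex \<Rightarrow> complex) set" where
  "hardy p = {g. g holomorphic_on upper_half_plane \<and>
     (\<exists>M. \<forall>y>0. integrable lborel (\<lambda>x. cmod (g (Complex x y)) powr p) \<and>
                (\<integral>x. cmod (g (Complex x y)) powr p \<partial>lborel) \<le> M)}"

definition hardy_inf :: "(complex \<Rightarrow> complex) set" where
  "hardy_inf = {g. g holomorphic_on upper_half_plane \<and>
     (\<exists>M. \<forall>z\<in>upper_half_plane. cmod (g z) \<le> M)}"

definition HpE :: "real \<Rightarrow> (complex \<Rightarrow> complex) \<Rightarrow> (complex \<Rightarrow> complex) set" where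
  "HpE p E = {f. f holomorphic_on UNIV \<and> (\<lambda>z. f z / E z) \<in> hardy p \<and>
                 (\<lambda>z. sharp f z / E z) \<in> hardy p}"

definition HinfE :: "(complex \<Rightarrow> complex) \<Rightarrow> (complex \<Rightarrow> complex) set" where
  "HinfE E = {f. f holomorphic_on UNIV \<and> (\<lambda>z. f z / E z) \<in> hardy_inf \<and>
                 (\<lambda>z. sharp f z / E z) \<in> hardy_inf}"

definition pnormE :: "real \<Rightarrow> (complex \<Rightarrow> complex) \<Rightarrow> (complex \<Rightarrow> complex) \<Rightarrow> real" where
  "pnormE p E f = (\<integral>x. cmod (f (of_real x) / E (of_real x)) powr p \<partial>lborel) powr (1 / p)"

definition supnormE :: "(complex \<Rightarrow> complex) \<Rightarrow> (complex \<Rightarrow> complex) \<Rightarrow> real" where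
  "supnormE E f = (SUP x::real. cmod (f (of_real x) / E (of_real x)))"

text \<open>\<open>C(p,E)\<close>: norm of the embedding \<open>\<H>^p(E) \<subseteq> \<H>^\<infinity>(E)\<close>, as an extended real
  (the supremum of \<open>\<parallel>f/E\<parallel>_\<infinity> / \<parallel>f/E\<parallel>_p\<close> over nonzero \<open>f\<close>; 0 if there are none).\<close>
definition embC :: "real \<Rightarrow> (complex \<Rightarrow> complex) \<Rightarrow> ereal" where
  "embC p E = Sup (insert 0 {ereal (supnormE E f / pnormE p E f) | f.
                    f \<in> HpE p E \<and> pnormE p E f \<noteq> 0})"

definition Kconst :: "real \<Rightarrow> real" where
  "Kconst p = (integral {-(pi/2)..pi/2} (\<lambda>x. \<bar>cos x\<bar> powr p)) powr (1 / p)"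

end

theory Submission
  imports Defs "HOL-Complex_Analysis.Complex_Analysis"
begin

text \<open>
  Let \<open>L\<close> be the supremum of \<open>\<bar>\<phi>'\<bar>\<close>, \<open>\<Theta> = E\<^sup>#/E\<close> and \<open>S = \<parallel>f/E\<parallel>\<^sub>\<infinity>\<close>. The core is a comparison with
  the cosine: if \<open>\<bar>f/E\<bar>\<close> equals \<open>S\<close> at \<open>x\<^sub>0\<close>, then \<open>\<bar>f/E\<bar> \<ge> S cos (L \<bar>x - x\<^sub>0\<bar> / 2)\<close> as long as the
  argument is at most \<open>\<pi>/2\<close>, and integrating the \<open>p\<close>-th powers gives the bound. As the supremum
  need not be attained, one starts at a near-maximum with a small initial angle \<open>\<theta>\<^sub>0\<close> instead.

  The comparison follows from a Bernstein--Szego inequality. After multiplication by a unimodular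
  constant and symmetrization under \<open>#\<close>, one may write \<open>f/E = e\<^bsup>i\<phi>/2\<^esup> g\<close> on the line with \<open>g\<close> real, and
  \<open>\<bar>g'\<bar> \<le> (\<phi>'/2) sqrt (1 - g\<^sup>2)\<close> if \<open>\<bar>g\<bar>\<close> is bounded by a constant less than 1; that is,
  \<open>arccos g\<close> is \<open>L/2\<close>-Lipschitz.

  The Phragmen--Lindelof arguments require \<open>f/E\<close> to be bounded. Since \<open>\<phi>'\<close> is bounded, \<open>\<Theta>\<close> is
  \<open>L\<close>-Lipschitz and hence bounded below near the line, so \<open>f/E\<close> continues to a strip below the
  line with uniformly bounded \<open>p\<close>-means on horizontal lines, which yields a pointwise bound.
\<close>

section \<open>Phragmen--Lindelof in the half-plane and inner functions\<close>


text \<open>Division by \<open>1 - \<i> * \<epsilon> * z\<close>, whose modulus is at least 1 and at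
  least \<open>\<epsilon> * cmod z\<close> in the closed half-plane, makes the bounded function
  small far out. The maximum modulus principle on a large half-disc then applies, and
  \<open>\<epsilon>\<close> tends to 0.\<close>

lemma phragmen_lindelof_half_plane:
  assumes hol: "G holomorphic_on upper_half_plane"
    and cont: "continuous_on {z. 0 \<le> Im z} G"
    and bound: "\<And>z. 0 < Im z \<Longrightarrow> cmod (G z) \<le> B"
    and real: "\<And>x::real. cmod (G (of_real x)) \<le> m"
    and z: "0 \<le> Im z"
  shows "cmod (G z) \<le> m"
proof (rule field_le_epsilon)
  fix e :: real
  assume e: "0 < e"
  have m0: "0 \<le> m"
    using real[of 0] norm_ge_zero order_trans by blast
  \<comment> \<open>The margin \<open>e\<close> keeps the bound positive even if
    \<open>m = 0\<close>, so that the radius below may have it as a denominator.\<close>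
  define m' where "m' = m + e"
  have m': "0 < m'" "m \<le> m'"
    using m0 e by (auto simp: m'_def)
  have main: "cmod (G z) \<le> m' * cmod (1 - \<i> * of_real \<epsilon> * z)" if \<epsilon>: "0 < \<epsilon>" for \<epsilon> :: real
  proof -
    define q where "q = (\<lambda>w::complex. 1 - \<i> * of_real \<epsilon> * w)"
    \<comment> \<open>The radius is so large that \<open>z\<close> lies inside and that
      \<open>\<bar>B\<bar>\<close> is at most \<open>m' * \<epsilon> * \<rho>\<close>, which settles
      the arc.\<close>
    define \<rho> where "\<rho> = max (cmod z + 1) (\<bar>B\<bar> / (m' * \<epsilon>))"
    have Reqn: "Re (q w) = 1 + \<epsilon> * Im w" for w
      by (simp add: q_def)
    have q1: "1 \<le> cmod (q w)" if "0 \<le> Im w" for w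
    proof -
      have "1 \<le> Re (q w)"
        using that \<epsilon> by (simp add: Reqn)
      also have "\<dots> \<le> cmod (q w)"
        by (rule complex_Re_le_cmod)
      finally show ?thesis .
    qed
    have q2: "\<epsilon> * cmod w \<le> cmod (q w)" if "0 \<le> Im w" for w
    proof -
      have "(cmod (q w))\<^sup>2 = (1 + \<epsilon> * Im w)\<^sup>2 + (\<epsilon> * Re w)\<^sup>2"
        by (simp add: cmod_power2 q_def)
      also have "\<dots> = (\<epsilon> * cmod w)\<^sup>2 + 1 + 2 * \<epsilon> * Im w"
        by (simp add: cmod_power2 power_mult_distrib) (simp add: power2_eq_square algebra_simps)
      also have "\<dots> \<ge> (\<epsilon> * cmod w)\<^sup>2"
        using that \<epsilon> by simp
      finally show ?thesis
        by (rule power2_le_imp_le) simp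
    qed
    have q0: "q w \<noteq> 0" if "0 \<le> Im w" for w
      using q1[OF that] by auto
    define S where "S = {w. 0 < Im w} \<inter> ball 0 \<rho>"
    have \<rho>: "cmod z < \<rho>" "\<bar>B\<bar> / (m' * \<epsilon>) \<le> \<rho>"
      by (auto simp: \<rho>_def)
    have opS: "open S"
      by (auto simp: S_def open_halfspace_Im_gt)
    have clS: "closure S \<subseteq> {w. 0 \<le> Im w} \<inter> cball 0 \<rho>"
    proof (rule closure_minimal)
      show "closed ({w. 0 \<le> Im w} \<inter> cball 0 \<rho>)"
        by (intro closed_Int closed_halfspace_Im_ge closed_cball)
    qed (auto simp: S_def)
    have contq: "continuous_on {w. 0 \<le> Im w} (\<lambda>w. G w / q w)"
    proof (intro continuous_on_divide cont)
      show "continuous_on {w. 0 \<le> Im w} q"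
        unfolding q_def by (intro continuous_intros)
    qed (use q0 in auto)
    have holq: "(\<lambda>w. G w / q w) holomorphic_on S"
    proof (rule holomorphic_on_divide)
      show "G holomorphic_on S"
        using hol by (rule holomorphic_on_subset) (auto simp: S_def upper_half_plane_def)
      show "q holomorphic_on S"
        unfolding q_def by (intro holomorphic_intros)
    qed (use q0 in \<open>auto simp: S_def\<close>)
    have S_le: "cmod (G w / q w) \<le> m'" if "w \<in> S" for w
    proof (rule maximum_modulus_frontier[of "\<lambda>w. G w / q w" S])
      show "(\<lambda>w. G w / q w) holomorphic_on interior S"
        using holq opS by (simp add: interior_open)
      show "continuous_on (closure S) (\<lambda>w. G w / q w)"
        using contq by (rule continuous_on_subset) (use clS in auto)
      show "bounded S"
        unfolding S_def by (rule bounded_subset[OF bounded_ball[of 0 \<rho>]]) auto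
      show "w \<in> S" by fact
      fix v assume v: "v \<in> frontier S"
      have vcl: "0 \<le> Im v" "cmod v \<le> \<rho>"
        using v clS by (auto simp: frontier_def)
      have "v \<notin> S"
        using v opS by (auto simp: frontier_def interior_open)
      then consider "Im v = 0" | "0 < Im v" "cmod v = \<rho>"
        using vcl by (fastforce simp: S_def)
      then show "cmod (G v / q v) \<le> m'"
      proof cases
        case 1
        then have "v = of_real (Re v)"
          by (simp add: complex_eq_iff)
        then have "cmod (G v) \<le> m'"
          using real[of "Re v"] m' by simp
        moreover have "cmod (G v) / cmod (q v) \<le> cmod (G v) / 1"
          using q1[OF vcl(1)] by (intro divide_left_mono) auto
        ultimately show ?thesis
          by (simp add: norm_divide)
      next
        case 2
        have "cmod (G v) \<le> \<bar>B\<bar>"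
          using bound[OF 2(1)] by linarith
        also have "\<dots> \<le> m' * (\<epsilon> * \<rho>)"
          using \<rho>(2) m' \<epsilon> by (simp add: field_simps)
        also have "\<dots> \<le> m' * cmod (q v)"
          using q2[OF vcl(1)] 2 m' by (intro mult_left_mono) auto
        finally have "cmod (G v) \<le> m' * cmod (q v)" .
        moreover have "0 < cmod (q v)"
          using q1[OF vcl(1)] by linarith
        ultimately show ?thesis
          by (simp add: norm_divide divide_le_eq)
      qed
    qed
    show ?thesis
    proof (cases "0 < Im z")
      case True
      then have "z \<in> S"
        using \<rho> by (simp add: S_def)
      then have "cmod (G z / q z) \<le> m'"
        by (rule S_le)
      moreover have "0 < cmod (q z)"
        using q1[OF z] by linarith
      ultimately show ?thesis
        by (simp add: norm_divide divide_le_eq q_def)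
    next
      case False
      then have "z = of_real (Re z)"
        using z by (simp add: complex_eq_iff)
      then have "cmod (G z) \<le> m' * 1"
        using real[of "Re z"] m' by simp
      also have "\<dots> \<le> m' * cmod (q z)"
        using q1[OF z] m' by (intro mult_left_mono) auto
      finally show ?thesis
        by (simp add: q_def)
    qed
  qed
  have "((\<lambda>\<epsilon>::real. m' * cmod (1 - \<i> * of_real \<epsilon> * z)) \<longlongrightarrow> m' * cmod (1 - \<i> * of_real 0 * z)) (at_right 0)"
    by (intro tendsto_intros)
  moreover have "\<forall>\<^sub>F \<epsilon> in at_right (0::real). cmod (G z) \<le> m' * cmod (1 - \<i> * of_real \<epsilon> * z)"
    using main by (auto simp: eventually_at_filter)
  ultimately have "cmod (G z) \<le> m' * cmod (1 - \<i> * of_real 0 * z)"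
    by (rule tendsto_lowerbound) simp
  then show "cmod (G z) \<le> m + e"
    by (simp add: m'_def)
qed

lemma norm_cis_diff_le: "cmod (cis a - cis b) \<le> \<bar>a - b\<bar>"
proof -
  have "cis a - cis b = cis b * (exp (\<i> * of_real (a - b)) - 1)"
    by (simp add: cis_conv_exp exp_diff right_diff_distrib)
  then have "cmod (cis a - cis b) = 2 * \<bar>sin ((a - b) / 2)\<bar>"
    by (simp only: norm_mult dist_exp_i_1) simp
  also have "\<dots> \<le> 2 * \<bar>(a - b) / 2\<bar>"
    by (intro mult_left_mono abs_sin_x_le_abs_x) auto
  finally show ?thesis
    by simp
qed

text \<open>The derivative is not known to be bounded a priori, so Phragmen--Lindelof is applied to the
  difference quotients along the real direction, which are.\<close>
lemma inner_function_derivative_bound: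
  fixes \<Theta> :: "complex \<Rightarrow> complex"
  assumes diff: "\<And>z. 0 \<le> Im z \<Longrightarrow> \<Theta> field_differentiable at z"
    and bd: "\<And>z. 0 < Im z \<Longrightarrow> cmod (\<Theta> z) \<le> 1"
    and lip: "\<And>x y::real. cmod (\<Theta> (of_real x) - \<Theta> (of_real y)) \<le> L * \<bar>x - y\<bar>"
    and z: "0 \<le> Im z"
  shows "cmod (deriv \<Theta> z) \<le> L"
proof -
  have le: "cmod (\<Theta> (z + of_real t) - \<Theta> z) \<le> L * \<bar>t\<bar>" for t :: real
  proof (rule phragmen_lindelof_half_plane[where G = "\<lambda>z. \<Theta> (z + of_real t) - \<Theta> z" and B = 2])
    have d: "(\<lambda>z. \<Theta> (z + of_real t) - \<Theta> z) field_differentiable at w" if "0 \<le> Im w" for w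
    proof -
      have "(\<lambda>z. z + of_real t) field_differentiable at w"
        by (intro field_differentiable_add field_differentiable_ident field_differentiable_const)
      then have "(\<lambda>z. \<Theta> (z + of_real t)) field_differentiable at w"
        using field_differentiable_compose[of "\<lambda>z. z + of_real t" w \<Theta>] diff[of "w + of_real t"] that
        by (simp add: o_def)
      then show ?thesis
        using diff[OF that] by (rule field_differentiable_diff)
    qed
    show "(\<lambda>z. \<Theta> (z + of_real t) - \<Theta> z) holomorphic_on upper_half_plane"
      by (auto simp: holomorphic_on_def upper_half_plane_def intro!: field_differentiable_at_within d)
    show "continuous_on {z. 0 \<le> Im z} (\<lambda>z. \<Theta> (z + of_real t) - \<Theta> z)"
      by (auto intro!: continuous_at_imp_continuous_on field_differentiable_imp_continuous_at d)
    show "cmod (\<Theta> (w + of_real t) - \<Theta> w) \<le> 2" if "0 < Im w" for w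
      using norm_triangle_ineq4[of "\<Theta> (w + of_real t)" "\<Theta> w"] bd[of w] bd[of "w + of_real t"] that by simp
    show "cmod (\<Theta> (of_real x + of_real t) - \<Theta> (of_real x)) \<le> L * \<bar>t\<bar>" for x
      using lip[of "x + t" x] by simp
  qed (use z in simp)
  have "((\<lambda>h. (\<Theta> (z + h) - \<Theta> z) / h) \<longlongrightarrow> deriv \<Theta> z) (at 0)"
    using diff[OF z] field_differentiable_derivI DERIV_def by blast
  \<comment> \<open>The complex derivative exists, so it may be computed along positive real
    increments, where the difference quotients are controlled.\<close>
  moreover have "filterlim (complex_of_real) (at 0) (at_right 0)"
    unfolding filterlim_at
    by (auto intro!: tendsto_eq_intros simp: eventually_at_filter)
  ultimately have "((\<lambda>t::real. (\<Theta> (z + of_real t) - \<Theta> z) / of_real t) \<longlongrightarrow> deriv \<Theta> z) (at_right 0)"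
    by (rule filterlim_compose)
  then have "((\<lambda>t::real. cmod ((\<Theta> (z + of_real t) - \<Theta> z) / of_real t)) \<longlongrightarrow> cmod (deriv \<Theta> z)) (at_right 0)"
    by (rule tendsto_norm)
  moreover have "\<forall>\<^sub>F t::real in at_right 0. cmod ((\<Theta> (z + of_real t) - \<Theta> z) / of_real t) \<le> L"
  proof (rule eventually_at_right_less[THEN eventually_mono])
    fix t :: real
    assume "0 < t"
    then show "cmod ((\<Theta> (z + of_real t) - \<Theta> z) / of_real t) \<le> L"
      using le[of t] by (simp add: norm_divide divide_le_eq)
  qed
  ultimately show ?thesis
    by (rule tendsto_upperbound) simp
qed

text \<open>The modulus is 1 at the foot point \<open>Re z\<close>, and the derivative is bounded by
  \<open>L\<close> on the closed half-plane, so moving up by \<open>Im z\<close> lowers the modulus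
  by at most \<open>L * Im z\<close>.\<close>

lemma inner_function_lower_bound:
  fixes \<Theta> :: "complex \<Rightarrow> complex"
  assumes diff: "\<And>z. 0 \<le> Im z \<Longrightarrow> \<Theta> field_differentiable at z"
    and bd: "\<And>z. 0 < Im z \<Longrightarrow> cmod (\<Theta> z) \<le> 1"
    and uni: "\<And>x::real. cmod (\<Theta> (of_real x)) = 1"
    and lip: "\<And>x y::real. cmod (\<Theta> (of_real x) - \<Theta> (of_real y)) \<le> L * \<bar>x - y\<bar>"
    and z: "0 \<le> Im z"
  shows "1 - L * Im z \<le> cmod (\<Theta> z)"
proof -
  have "cmod (\<Theta> (of_real (Re z)) - \<Theta> z) \<le> L * cmod (of_real (Re z) - z)"
  proof (rule field_differentiable_bound[OF convex_halfspace_Im_ge[of 0]])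
    show "(\<Theta> has_field_derivative deriv \<Theta> w) (at w within {w. 0 \<le> Im w})"
      if "w \<in> {w. 0 \<le> Im w}" for w
      using that diff field_differentiable_derivI has_field_derivative_at_within by blast
    show "cmod (deriv \<Theta> w) \<le> L" if "w \<in> {w. 0 \<le> Im w}" for w
      using that inner_function_derivative_bound[of \<Theta> L w] diff bd lip by auto
  qed (use z in auto)
  moreover have "cmod (of_real (Re z) - z) = Im z"
    using z by (simp add: cmod_def)
  ultimately show ?thesis
    using uni[of "Re z"] norm_triangle_ineq2[of "\<Theta> (of_real (Re z))" "\<Theta> z"] by simp
qed


section \<open>Pointwise bounds from means on horizontal lines\<close>

text \<open>Affine substitution; it turns the horizontal sides of a rectangle into ordinary
  integrals, to which bounds on means apply.\<close>

lemma has_contour_integral_linepath_same_Im: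
  assumes "Im a = y" "Im b = y" "Re a < Re b"
    and "(f has_contour_integral I) (linepath a b)"
  shows "((\<lambda>x. f (Complex x y)) has_integral I) {Re a..Re b}"
proof -
  have "((\<lambda>t. f (linepath a b t) * (b - a)) has_integral I) {0..1}"
    using assms(4) by (simp add: has_contour_integral_linepath)
  moreover have "(\<lambda>t. f (linepath a b t) * (b - a)) =
      (\<lambda>t. (Re b - Re a) *\<^sub>R f (Complex ((Re b - Re a) *\<^sub>R t + Re a) y))"
  proof
    fix t
    have "linepath a b t = Complex ((Re b - Re a) *\<^sub>R t + Re a) y"
      using assms(1,2) by (simp add: linepath_def complex_eq_iff algebra_simps)
    moreover have "b - a = of_real (Re b - Re a)"
      using assms(1,2) by (simp add: complex_eq_iff)
    ultimately show "f (linepath a b t) * (b - a) =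
        (Re b - Re a) *\<^sub>R f (Complex ((Re b - Re a) *\<^sub>R t + Re a) y)"
      by (simp add: scaleR_conv_of_real)
  qed
  ultimately have "((\<lambda>t. f (Complex ((Re b - Re a) *\<^sub>R t + Re a) y)) has_integral I /\<^sub>R (Re b - Re a)) {0..1}"
    using assms(3)
    by (auto dest: has_integral_cmul[where c = "inverse (Re b - Re a)"])
  then show ?thesis
    using has_integral_affinity_iff[of "Re b - Re a" "\<lambda>x. f (Complex x y)" "Re a" I "Re a" "Re b"] assms(3)
    by simp
qed

text \<open>Cauchy's formula at the centre. On the vertical sides, of length \<open>2 * b\<close>,
  the kernel is at most \<open>1 / a\<close> and \<open>h\<close> is bounded pointwise; on the
  horizontal sides the kernel is at most \<open>1 / b\<close> and only the mean of \<open>h\<close>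
  is used. A flat rectangle makes the pointwise bound \<open>S\<close> count little.\<close>

lemma cauchy_rectangle_bound:
  assumes hol: "h holomorphic_on cbox (Complex (x0 - a) (y0 - b)) (Complex (x0 + a) (y0 + b))"
    and ab: "0 < a" "0 < b"
    and vert: "\<And>x y. \<bar>x - x0\<bar> = a \<Longrightarrow> \<bar>y - y0\<bar> \<le> b \<Longrightarrow> cmod (h (Complex x y)) \<le> S"
    and hor: "\<And>y. \<bar>y - y0\<bar> = b \<Longrightarrow>
        integral {x0 - a..x0 + a} (\<lambda>x. cmod (h (Complex x y))) \<le> J"
  shows "cmod (h (Complex x0 y0)) \<le> (2 * b * S / a + J / b) / pi"
proof -
  define z0 where "z0 = Complex x0 y0"
  define p1 p2 p3 p4 where "p1 = Complex (x0 - a) (y0 - b)" and "p2 = Complex (x0 + a) (y0 - b)"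
    and "p3 = Complex (x0 + a) (y0 + b)" and "p4 = Complex (x0 - a) (y0 + b)"
  note p_defs = p1_def p2_def p3_def p4_def
  define R where "R = cbox p1 p3"
  define g where "g = (\<lambda>w. h w / (w - z0))"
  have holR: "h holomorphic_on R"
    using hol by (simp add: R_def p_defs)
  have z0R: "z0 \<in> box p1 p3"
    using ab by (simp add: in_box_complex_iff z0_def p_defs)
  have "(g has_contour_integral (2 * pi * \<i> * winding_number (rectpath p1 p3) z0 * h z0)) (rectpath p1 p3)"
    unfolding g_def
  proof (rule Cauchy_integral_formula_convex_simple[OF _ holR])
    show "path_image (rectpath p1 p3) \<subseteq> R - {z0}"
      using ab z0R path_image_rectpath_cbox_minus_box[of p1 p3] by (auto simp: R_def p_defs)
  qed (use z0R in \<open>auto simp: R_def convex_box\<close>)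
  then have *: "(g has_contour_integral (2 * pi * \<i> * h z0)) (rectpath p1 p3)"
    using winding_number_rectpath[OF z0R] by simp
  have rp: "rectpath p1 p3 = linepath p1 p2 +++ linepath p2 p3 +++ linepath p3 p4 +++ linepath p4 p1"
    by (simp add: rectpath_def Let_def p_defs)
  have contR: "continuous_on (R - {z0}) g"
    unfolding g_def
    by (intro continuous_intros continuous_on_subset[OF holomorphic_on_imp_continuous_on[OF holR]]) auto
  have seg: "closed_segment u v \<subseteq> R - {z0}"
    if "(u, v) \<in> {(p1, p2), (p2, p3), (p3, p4), (p4, p1), (p4, p3)}" for u v
  proof -
    have "closed_segment u v \<subseteq> R"
      using that ab by (intro closed_segment_subset) (auto simp: R_def p_defs in_cbox_complex_iff)
    moreover have "z0 \<notin> closed_segment u v"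
      using that ab
      by (auto simp: z0_def p_defs closed_segment_same_Re closed_segment_same_Im)
    ultimately show ?thesis
      by blast
  qed
  have ci: "(g has_contour_integral contour_integral (linepath u v) g) (linepath u v)"
    if "(u, v) \<in> {(p1, p2), (p2, p3), (p3, p4), (p4, p1), (p4, p3)}" for u v
    using contour_integrable_continuous_linepath[OF continuous_on_subset[OF contR seg[OF that]]]
    by (rule has_contour_integral_integral)
  have "(g has_contour_integral (contour_integral (linepath p1 p2) g + (contour_integral (linepath p2 p3) g
      + (contour_integral (linepath p3 p4) g + contour_integral (linepath p4 p1) g)))) (rectpath p1 p3)"
    unfolding rp by (intro has_contour_integral_join ci valid_path_join valid_path_linepath) auto
  then have sum: "2 * pi * \<i> * h z0 = contour_integral (linepath p1 p2) g + (contour_integral (linepath p2 p3) g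
      + (contour_integral (linepath p3 p4) g + contour_integral (linepath p4 p1) g))"
    using * has_contour_integral_unique by blast
  have S0: "0 \<le> S"
    using vert[of "x0 + a" y0] ab norm_ge_zero order_trans by (metis abs_of_pos add_diff_cancel_left' diff_self abs_zero less_imp_le)
  have V: "cmod (contour_integral (linepath u v) g) \<le> S / a * (2 * b)"
    if uv: "(u, v) \<in> {(p2, p3), (p4, p1)}" for u v
  proof -
    have "cmod (contour_integral (linepath u v) g) \<le> S / a * cmod (v - u)"
    proof (rule has_contour_integral_bound_linepath)
      show "(g has_contour_integral contour_integral (linepath u v) g) (linepath u v)"
        using uv by (intro ci) auto
      fix w assume w: "w \<in> closed_segment u v"
      have 1: "\<bar>Re w - x0\<bar> = a" "\<bar>Im w - y0\<bar> \<le> b"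
        using w uv ab by (auto simp: p_defs closed_segment_same_Re closed_segment_eq_real_ivl split: if_splits)
      have 2: "cmod (h w) \<le> S"
        using vert[OF 1] by simp
      have 3: "a \<le> cmod (w - z0)"
        using abs_Re_le_cmod[of "w - z0"] 1 by (simp add: z0_def)
      show "cmod (g w) \<le> S / a"
        unfolding g_def norm_divide using 2 3 ab S0 by (intro frac_le) auto
    qed (use S0 ab in auto)
    moreover have "cmod (v - u) = 2 * b"
      using uv ab by (auto simp: p_defs cmod_eq_Im)
    ultimately show ?thesis
      by simp
  qed
  have H: "cmod (contour_integral (linepath u v) g) \<le> J / b"
    if uv: "(u, v) \<in> {(p1, p2), (p4, p3)}" for u v
  proof -
    define y where "y = Im u"
    have y: "Im u = y" "Im v = y" "Re u = x0 - a" "Re v = x0 + a" "\<bar>y - y0\<bar> = b"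
      using uv ab by (auto simp: p_defs y_def)
    have "(g has_contour_integral contour_integral (linepath u v) g) (linepath u v)"
      using uv by (intro ci) auto
    from has_contour_integral_linepath_same_Im[OF y(1,2) _ this]
    have I: "((\<lambda>x. g (Complex x y)) has_integral contour_integral (linepath u v) g) {x0 - a..x0 + a}"
      using y ab by simp
    have "continuous_on {x0 - a..x0 + a} (\<lambda>x. h (Complex x y))"
      by (rule continuous_on_compose2[OF holomorphic_on_imp_continuous_on[OF holR]])
         (use y in \<open>auto intro!: continuous_intros simp: Complex_eq R_def p_defs in_cbox_complex_iff\<close>)
    then have ih: "(\<lambda>x. cmod (h (Complex x y)) / b) integrable_on {x0 - a..x0 + a}"
      using ab by (intro integrable_continuous_real continuous_intros) auto
    have "cmod (integral {x0 - a..x0 + a} (\<lambda>x. g (Complex x y)))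
        \<le> integral {x0 - a..x0 + a} (\<lambda>x. cmod (h (Complex x y)) / b)"
    proof (rule integral_norm_bound_integral[OF _ ih])
      show "(\<lambda>x. g (Complex x y)) integrable_on {x0 - a..x0 + a}"
        using I by blast
      fix x assume "x \<in> {x0 - a..x0 + a}"
      have "b \<le> cmod (Complex x y - z0)"
        using abs_Im_le_cmod[of "Complex x y - z0"] y by (simp add: z0_def)
      then show "cmod (g (Complex x y)) \<le> cmod (h (Complex x y)) / b"
        unfolding g_def norm_divide using ab by (intro divide_left_mono mult_pos_pos) auto
    qed
    also have "\<dots> = integral {x0 - a..x0 + a} (\<lambda>x. cmod (h (Complex x y))) / b"
      by simp
    also have "\<dots> \<le> J / b"
      using hor[OF y(5)] ab by (intro divide_right_mono) auto
    finally show ?thesis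
      using I by (simp add: integral_unique)
  qed
  \<comment> \<open>The boundary traverses the top side from right to left, whereas \<open>H\<close>
    treats it from left to right.\<close>
  have "contour_integral (linepath p3 p4) g = - contour_integral (linepath p4 p3) g"
    by (rule contour_integral_reverse_linepath[OF continuous_on_subset[OF contR seg]]) simp
  then have H': "cmod (contour_integral (linepath p3 p4) g) \<le> J / b"
    using H[of p4 p3] by simp
  have "2 * pi * cmod (h z0) = cmod (2 * pi * \<i> * h z0)"
    by (simp add: norm_mult)
  also have "\<dots> \<le> J / b + (S / a * (2 * b) + (J / b + S / a * (2 * b)))"
    unfolding sum using V[of p2 p3] V[of p4 p1] H[of p1 p2] H'
    by (intro norm_triangle_le add_mono order_refl) auto
  also have "\<dots> = 2 * (2 * b * S / a + J / b)"
    by simp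
  finally have "pi * cmod (h z0) \<le> 2 * b * S / a + J / b"
    by simp
  then show ?thesis
    by (simp add: z0_def pos_le_divide_eq mult.commute)
qed

text \<open>At a maximum point of \<open>\<bar>h\<bar>\<^sup>q d\<close>, with \<open>d\<close> the distance to the boundary of the square, the values of
  \<open>\<bar>h\<bar>\<close> nearby exceed the value there at most by the factor \<open>K = 2\<^bsup>1/q\<^esup>\<close>. In Cauchy's formula on a
  rectangle that is flat enough (\<open>\<epsilon> = \<pi>/(4K)\<close>) the vertical sides therefore contribute at most half
  of that value and can be absorbed.\<close>
lemma holomorphic_bound_of_line_integrals:
  fixes h :: "complex \<Rightarrow> complex" and q R M :: real
  assumes q: "0 < q" "q \<le> 1" and R: "0 < R"
    and hol: "h holomorphic_on cbox (Complex (x0 - R) (y0 - R)) (Complex (x0 + R) (y0 + R))"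
    and int: "\<And>y. \<bar>y - y0\<bar> \<le> R \<Longrightarrow>
        integral {x0 - R..x0 + R} (\<lambda>x. cmod (h (Complex x y)) powr q) \<le> M"
  shows "cmod (h (Complex x0 y0)) powr q \<le> 16 * M * 4 powr (1 / q) / (pi\<^sup>2 * R)"
proof -
  define K where "K = 2 powr (1 / q)"
  have K: "2 \<le> K"
  proof -
    have "2 powr 1 \<le> (2::real) powr (1 / q)"
      using q by (intro powr_mono) (auto simp: field_simps)
    then show ?thesis
      by (simp add: K_def)
  qed
  define Q where "Q = cbox (Complex (x0 - R) (y0 - R)) (Complex (x0 + R) (y0 + R))"
  define d where "d = (\<lambda>z. R - max \<bar>Re z - x0\<bar> \<bar>Im z - y0\<bar>)"
  have Q_iff: "z \<in> Q \<longleftrightarrow> 0 \<le> d z" for z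
    by (auto simp: Q_def d_def in_cbox_complex_iff abs_le_iff)
  have conth: "continuous_on Q h"
    using hol by (simp add: Q_def holomorphic_on_imp_continuous_on)
  define F where "F = (\<lambda>z. cmod (h z) powr q * d z)"
  have "continuous_on Q F"
    unfolding F_def d_def using q
    by (intro continuous_intros continuous_on_powr' conth) auto
  moreover have "compact Q" "Q \<noteq> {}"
    using R Q_iff[of "Complex x0 y0"] by (auto simp: Q_def d_def)
  ultimately obtain z where z: "z \<in> Q" and zmax: "\<And>w. w \<in> Q \<Longrightarrow> F w \<le> F z"
    using continuous_attains_sup[of Q F] by blast
  define T where "T = cmod (h z)"
  have F0: "F (Complex x0 y0) = cmod (h (Complex x0 y0)) powr q * R"
    by (simp add: F_def d_def)
  have center: "Complex x0 y0 \<in> Q"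
    using R by (simp add: Q_iff d_def)
  have M0: "0 \<le> M"
  proof -
    have "0 \<le> integral {x0 - R..x0 + R} (\<lambda>x. cmod (h (Complex x y0)) powr q)"
      by (cases "(\<lambda>x. cmod (h (Complex x y0)) powr q) integrable_on {x0 - R..x0 + R}")
         (auto intro: integral_nonneg simp: not_integrable_integral)
    then show ?thesis
      using int[of y0] R by linarith
  qed
  have main: "F z \<le> 16 * M * 4 powr (1 / q) / pi\<^sup>2"
  proof (cases "F z \<le> 0")
    case True
    then show ?thesis
      using M0 by (meson divide_nonneg_nonneg mult_nonneg_nonneg order_trans powr_ge_zero zero_le_numeral zero_le_power2)
  next
    case False
    then have dz: "0 < d z" and T0: "0 < T"
      using z Q_iff[of z] by (auto simp: F_def T_def zero_less_mult_iff order_less_le)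
    define r where "r = d z / 2"
    define \<epsilon> where "\<epsilon> = pi / (4 * K)"
    define S where "S = K * T"
    have r: "0 < r"
      using dz by (simp add: r_def)
    have "pi < 4"
      using pi_less_4 .
    then have \<epsilon>: "0 < \<epsilon>" "\<epsilon> \<le> 1"
      using K by (auto simp: \<epsilon>_def field_simps)
    have er: "0 < \<epsilon> * r" "\<epsilon> * r \<le> r"
      using \<epsilon> r by auto
    \<comment> \<open>Within \<open>r\<close> of \<open>z\<close> in both coordinates,
      \<open>d\<close> is still at least \<open>r\<close>, half its value at \<open>z\<close>, so
      maximality of \<open>F\<close> gives
      \<open>cmod (h w) powr q \<le> 2 * T powr q\<close>.\<close>
    have near: "w \<in> Q \<and> cmod (h w) \<le> S" if "\<bar>Re w - Re z\<bar> \<le> r" "\<bar>Im w - Im z\<bar> \<le> r" for w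
    proof -
      have dw: "r \<le> d w"
      proof -
        have "max \<bar>Re w - x0\<bar> \<bar>Im w - y0\<bar> \<le> max \<bar>Re z - x0\<bar> \<bar>Im z - y0\<bar> + r"
          using that max.cobounded1[of "\<bar>Re z - x0\<bar>" "\<bar>Im z - y0\<bar>"]
            max.cobounded2[of "\<bar>Im z - y0\<bar>" "\<bar>Re z - x0\<bar>"]
          by (intro max.boundedI) linarith+
        moreover have "R - max \<bar>Re z - x0\<bar> \<bar>Im z - y0\<bar> = 2 * r"
          by (simp add: r_def d_def)
        ultimately show ?thesis
          unfolding d_def by linarith
      qed
      then have wQ: "w \<in> Q"
        using r by (simp add: Q_iff)
      have "cmod (h w) powr q * r \<le> cmod (h w) powr q * d w"
        using dw by (intro mult_left_mono) auto
      also have "\<dots> \<le> T powr q * (2 * r)"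
        using zmax[OF wQ] by (simp add: F_def T_def r_def)
      finally have "cmod (h w) powr q \<le> 2 * T powr q"
        using r by simp
      then have "(cmod (h w) powr q) powr (1 / q) \<le> (2 * T powr q) powr (1 / q)"
        using q by (intro powr_mono2) auto
      also have "\<dots> = S"
        using q T0 by (simp add: powr_mult powr_powr S_def K_def)
      finally show ?thesis
        using wQ q by (simp add: powr_powr)
    qed
    have S0: "0 < S"
      using T0 K by (simp add: S_def)
    have "cmod (h (Complex (Re z) (Im z)))
        \<le> (2 * (\<epsilon> * r) * S / r + (S powr (1 - q) * M) / (\<epsilon> * r)) / pi"
    proof (rule cauchy_rectangle_bound)
      show "h holomorphic_on cbox (Complex (Re z - r) (Im z - \<epsilon> * r)) (Complex (Re z + r) (Im z + \<epsilon> * r))"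
      proof (rule holomorphic_on_subset[OF hol[folded Q_def]], rule subsetI)
        fix w assume "w \<in> cbox (Complex (Re z - r) (Im z - \<epsilon> * r)) (Complex (Re z + r) (Im z + \<epsilon> * r))"
        then show "w \<in> Q"
          using near[of w] er by (auto simp: in_cbox_complex_iff abs_le_iff)
      qed
      show "cmod (h (Complex x y)) \<le> S" if "\<bar>x - Re z\<bar> = r" "\<bar>y - Im z\<bar> \<le> \<epsilon> * r" for x y
        using near[of "Complex x y"] that er by auto
      fix y assume y: "\<bar>y - Im z\<bar> = \<epsilon> * r"
      have sub: "{Re z - r..Re z + r} \<subseteq> {x0 - R..x0 + R}" "\<bar>y - y0\<bar> \<le> R"
        using near[of "Complex (Re z - r) y"] near[of "Complex (Re z + r) y"] y er r
        by (auto simp: Q_def in_cbox_complex_iff)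
      have cont: "continuous_on {x0 - R..x0 + R} (\<lambda>x. h (Complex x y))"
        by (rule continuous_on_compose2[OF conth])
           (use sub in \<open>auto intro!: continuous_intros simp: Complex_eq Q_def in_cbox_complex_iff\<close>)
      have ci: "(\<lambda>x. cmod (h (Complex x y)) powr q) integrable_on {x0 - R..x0 + R}"
        using cont q by (intro integrable_continuous_real continuous_on_powr' continuous_intros) auto
      then have ci': "(\<lambda>x. cmod (h (Complex x y)) powr q) integrable_on {Re z - r..Re z + r}"
        by (rule integrable_subinterval_real) (use sub in auto)
      \<comment> \<open>Since \<open>q \<le> 1\<close> and \<open>cmod h \<le> S\<close> here, the
        factor \<open>cmod h powr (1 - q)\<close> can be pulled out as
        \<open>S powr (1 - q)\<close>, which turns the bound on the \<open>q\<close>-mean into one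
        on the mean.\<close>
      have "integral {Re z - r..Re z + r} (\<lambda>x. cmod (h (Complex x y)))
          \<le> integral {Re z - r..Re z + r} (\<lambda>x. S powr (1 - q) * cmod (h (Complex x y)) powr q)"
      proof (rule integral_le)
        show "(\<lambda>x. cmod (h (Complex x y))) integrable_on {Re z - r..Re z + r}"
          using continuous_on_subset[OF cont sub(1)] by (intro integrable_continuous_real continuous_intros)
        show "(\<lambda>x. S powr (1 - q) * cmod (h (Complex x y)) powr q) integrable_on {Re z - r..Re z + r}"
          using integrable_on_cmult_left[OF ci'] by simp
        fix x assume x: "x \<in> {Re z - r..Re z + r}"
        define t where "t = cmod (h (Complex x y))"
        have t: "0 \<le> t" "t \<le> S"
          using near[of "Complex x y"] x y er by (auto simp: t_def)
        have "t = t powr (1 - q) * t powr q"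
          using t by (cases "t = 0") (simp_all flip: powr_add)
        also have "\<dots> \<le> S powr (1 - q) * t powr q"
          using t q by (intro mult_right_mono powr_mono2) auto
        finally show "cmod (h (Complex x y)) \<le> S powr (1 - q) * cmod (h (Complex x y)) powr q"
          by (simp add: t_def)
      qed
      also have "\<dots> = S powr (1 - q) * integral {Re z - r..Re z + r} (\<lambda>x. cmod (h (Complex x y)) powr q)"
        by simp
      also have "\<dots> \<le> S powr (1 - q) * integral {x0 - R..x0 + R} (\<lambda>x. cmod (h (Complex x y)) powr q)"
        using sub ci ci' by (intro mult_left_mono integral_subset_le) auto
      also have "\<dots> \<le> S powr (1 - q) * M"
        using int[OF sub(2)] by (intro mult_left_mono) auto
      finally show "integral {Re z - r..Re z + r} (\<lambda>x. cmod (h (Complex x y))) \<le> S powr (1 - q) * M" .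
    qed (use r er in auto)
    also have "2 * (\<epsilon> * r) * S / r = pi * T / 2"
      using r K by (simp add: \<epsilon>_def S_def field_simps)
    finally have "T \<le> T / 2 + S powr (1 - q) * M / (\<epsilon> * r) / pi"
      by (simp add: T_def add_divide_distrib)
    then have "T \<le> 2 * (S powr (1 - q) * M / (\<epsilon> * r) / pi)"
      by simp
    \<comment> \<open>With \<open>S = K * T\<close> the factor \<open>T powr (1 - q)\<close> appears
      on the right; cancelling it leaves \<open>T powr q\<close> on the left.\<close>
    also have "\<dots> = T powr (1 - q) * (K powr (1 - q) * (16 * M * K / (2 * r * pi\<^sup>2)))"
      using K r T0 by (simp add: \<epsilon>_def S_def powr_mult field_simps power2_eq_square)
    finally have "T powr (1 - q) * T powr q \<le> T powr (1 - q) * (K powr (1 - q) * (16 * M * K / (2 * r * pi\<^sup>2)))"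
      using T0 by (simp flip: powr_add)
    then have "T powr q \<le> K powr (1 - q) * (16 * M * K / (2 * r * pi\<^sup>2))"
      using T0 by (subst (asm) mult_le_cancel_left_pos) auto
    also have "\<dots> \<le> K powr 1 * (16 * M * K / (2 * r * pi\<^sup>2))"
      using K r M0 q by (intro mult_right_mono powr_mono) auto
    finally have "T powr q * (2 * r) \<le> 16 * M * (K * K) / pi\<^sup>2"
      using K r by (simp add: field_simps)
    moreover have "K * K = 4 powr (1 / q)"
      by (simp add: K_def flip: powr_mult)
    ultimately show ?thesis
      by (simp add: F_def T_def r_def)
  qed
  have "cmod (h (Complex x0 y0)) powr q * R \<le> 16 * M * 4 powr (1 / q) / pi\<^sup>2"
    using zmax[OF center] main F0 by linarith
  then show ?thesis
    using R by (simp add: field_simps)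
qed


section \<open>A Bernstein--Szego inequality\<close>

text \<open>The curve moves in direction \<open>\<i>\<close>, so the derivative is twice the real
  part of \<open>cnj (A z) * (\<i> * A')\<close>.\<close>

lemma DERIV_norm_square_vertical:
  assumes "(A has_field_derivative A') (at z)"
  shows "((\<lambda>t. (cmod (A (z + \<i> * of_real t)))\<^sup>2) has_real_derivative - 2 * Im (cnj (A z) * A')) (at 0)"
proof -
  define F where "F = (\<lambda>t. A (z + \<i> * of_real t))"
  have "((\<lambda>t. z + \<i> * of_real t) has_vector_derivative \<i>) (at (0::real))"
    by (auto intro!: derivative_eq_intros)
  then have "(F has_vector_derivative \<i> * A') (at 0)"
    using field_vector_diff_chain_at[of "\<lambda>t. z + \<i> * of_real t" \<i> 0 A A'] assms
    by (simp add: F_def o_def)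
  then have F: "(F has_derivative (\<lambda>h. h *\<^sub>R (\<i> * A'))) (at 0)"
    by (simp add: has_vector_derivative_def)
  have "((\<lambda>t. F t \<bullet> F t) has_derivative (\<lambda>h. F 0 \<bullet> (h *\<^sub>R (\<i> * A')) + (h *\<^sub>R (\<i> * A')) \<bullet> F 0)) (at 0)"
    by (rule has_derivative_inner[OF F F])
  moreover have "(\<lambda>h. F 0 \<bullet> (h *\<^sub>R (\<i> * A')) + (h *\<^sub>R (\<i> * A')) \<bullet> F 0) = (*) (- 2 * Im (cnj (A z) * A'))"
    by (auto simp: F_def inner_complex_def algebra_simps)
  ultimately show ?thesis
    by (simp add: has_field_derivative_def F_def power2_norm_eq_inner)
qed

lemma DERIV_nonneg_at_right_minimum:
  fixes N :: "real \<Rightarrow> real"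
  assumes "(N has_real_derivative D) (at a)" "\<And>t. a \<le> t \<Longrightarrow> N a \<le> N t"
  shows "0 \<le> D"
proof (rule ccontr)
  assume "\<not> 0 \<le> D"
  then obtain d where "0 < d" "\<And>h. 0 < h \<Longrightarrow> h < d \<Longrightarrow> N (a + h) < N a"
    using DERIV_neg_dec_right[OF assms(1)] by auto
  then have "N (a + d / 2) < N a"
    by simp
  with assms(2)[of "a + d / 2"] \<open>0 < d\<close> show False
    by simp
qed

lemma cis_has_vector_derivative:
  assumes "(\<phi> has_real_derivative \<phi>') (at x)"
  shows "((\<lambda>x. cis (\<phi> x)) has_vector_derivative \<phi>' *\<^sub>R (\<i> * cis (\<phi> x))) (at x)"
proof -
  have "(\<phi> has_vector_derivative \<phi>') (at x)"
    using assms by (simp add: has_real_derivative_iff_has_vector_derivative)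
  then have "((\<lambda>x. \<i> * of_real (\<phi> x)) has_vector_derivative (of_real \<phi>' * \<i>)) (at x)"
    by (auto intro!: derivative_eq_intros simp: has_vector_derivative_def scaleR_conv_of_real mult_ac)
  then show ?thesis
    using field_vector_diff_chain_at[OF _ DERIV_exp]
    by (force simp: o_def cis_conv_exp scaleR_conv_of_real mult_ac)
qed

lemma real_line_has_vector_derivative:
  fixes F :: "complex \<Rightarrow> complex"
  assumes "(F has_field_derivative F') (at (of_real x))"
  shows "((\<lambda>x. F (of_real x)) has_vector_derivative F') (at x)"
  using field_vector_diff_chain_at[OF has_vector_derivative_of_real[OF DERIV_ident] assms]
  by (simp add: o_def)

text \<open>For unimodular \<open>u\<close> the inequality \<open>\<bar>\<Theta> - cnj u H\<bar> \<le> \<bar>1 - u H\<bar>\<close> is an equality on the real line,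
  hence holds in the half-plane, so the vertical derivative of the difference of squares at \<open>x\<^sub>0\<close> is
  nonnegative. The two choices of \<open>u\<close> with \<open>u e\<^bsup>i\<phi>/2\<^esup> = g \<plusminus> i sqrt (1 - g\<^sup>2)\<close> at \<open>x\<^sub>0\<close> turn this into the claim.\<close>
lemma bernstein_szego_half_plane:
  fixes \<Theta> H :: "complex \<Rightarrow> complex" and \<phi> g :: "real \<Rightarrow> real"
  assumes d\<Theta>: "\<And>z. 0 \<le> Im z \<Longrightarrow> \<Theta> field_differentiable at z"
    and dH: "\<And>z. 0 \<le> Im z \<Longrightarrow> H field_differentiable at z"
    and \<Theta>_le: "\<And>z. 0 < Im z \<Longrightarrow> cmod (\<Theta> z) \<le> 1"
    and H_le: "\<And>z. 0 < Im z \<Longrightarrow> cmod (H z) \<le> B"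
    and \<Theta>_real: "\<And>x. \<Theta> (of_real x) = cis (\<phi> x)"
    and H_real: "\<And>x. H (of_real x) = cis (\<phi> x / 2) * of_real (g x)"
    and g_le: "\<And>x. \<bar>g x\<bar> \<le> k" and k1: "k < 1"
    and d\<phi>: "(\<phi> has_real_derivative \<phi>') (at x0)"
  shows "\<exists>g'. (g has_real_derivative g') (at x0) \<and> \<bar>g'\<bar> \<le> \<phi>' / 2 * sqrt (1 - (g x0)\<^sup>2)"
proof -
  have k0: "0 \<le> k"
    using g_le[of 0] by linarith
  define c where "c = cis (\<phi> x0 / 2)"
  define \<gamma> where "\<gamma> = g x0"
  define s where "s = sqrt (1 - \<gamma>\<^sup>2)"
  have "\<gamma>\<^sup>2 < 1"
    using g_le[of x0] k1 by (simp add: \<gamma>_def abs_square_less_1)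
  then have s: "0 < s" "s\<^sup>2 = 1 - \<gamma>\<^sup>2"
    by (auto simp: s_def)
  \<comment> \<open>The a priori bound \<open>B\<close> makes Phragmen--Lindelof applicable, which
    improves it to the bound on the line.\<close>
  have Hk: "cmod (H z) \<le> k" if "0 \<le> Im z" for z
  proof (rule phragmen_lindelof_half_plane[OF _ _ H_le _ that])
    show "H holomorphic_on upper_half_plane"
      by (auto simp: holomorphic_on_def upper_half_plane_def intro!: field_differentiable_at_within dH)
    show "continuous_on {z. 0 \<le> Im z} H"
      by (auto intro!: continuous_at_imp_continuous_on field_differentiable_imp_continuous_at dH)
  qed (use g_le in \<open>auto simp: H_real norm_mult\<close>)
  have ineq: "cmod (\<Theta> z - cnj u * H z) \<le> cmod (1 - u * H z)" if u: "cmod u = 1" and z: "0 \<le> Im z" for u z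
  proof -
    \<comment> \<open>As \<open>k < 1\<close>, the denominator stays away from zero, so the quotient
      is analytic and bounded and Phragmen--Lindelof applies to it.\<close>
    have den: "1 - k \<le> cmod (1 - u * H w)" if "0 \<le> Im w" for w
      using norm_triangle_ineq2[of 1 "u * H w"] Hk[OF that] u by (simp add: norm_mult)
    then have den0: "1 - u * H w \<noteq> 0" if "0 \<le> Im w" for w
      using that k1 by fastforce
    have dG: "(\<lambda>z. (\<Theta> z - cnj u * H z) / (1 - u * H z)) field_differentiable at w" if "0 \<le> Im w" for w
      using that by (intro derivative_intros d\<Theta> dH den0)
    have "cmod ((\<Theta> z - cnj u * H z) / (1 - u * H z)) \<le> 1"
    proof (rule phragmen_lindelof_half_plane[where B = "(1 + k) / (1 - k)"
            and G = "\<lambda>z. (\<Theta> z - cnj u * H z) / (1 - u * H z)"])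
      show "(\<lambda>z. (\<Theta> z - cnj u * H z) / (1 - u * H z)) holomorphic_on upper_half_plane"
        by (auto simp: holomorphic_on_def upper_half_plane_def intro!: field_differentiable_at_within dG)
      show "continuous_on {z. 0 \<le> Im z} (\<lambda>z. (\<Theta> z - cnj u * H z) / (1 - u * H z))"
        by (auto intro!: continuous_at_imp_continuous_on field_differentiable_imp_continuous_at dG)
      show "cmod ((\<Theta> w - cnj u * H w) / (1 - u * H w)) \<le> (1 + k) / (1 - k)" if w: "0 < Im w" for w
      proof -
        have "cmod (\<Theta> w - cnj u * H w) \<le> 1 + k"
          using norm_triangle_ineq4[of "\<Theta> w" "cnj u * H w"] \<Theta>_le[OF w] Hk[of w] u w
          by (simp add: norm_mult)
        then show ?thesis
          unfolding norm_divide using den[of w] w k1 k0 by (intro frac_le) auto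
      qed
      \<comment> \<open>On the line \<open>\<Theta> = e * e\<close>, and the numerator is
        \<open>e * e\<close> times the conjugate of the denominator.\<close>
      show "cmod ((\<Theta> (of_real x) - cnj u * H (of_real x)) / (1 - u * H (of_real x))) \<le> 1" for x
      proof -
        define e where "e = cis (\<phi> x / 2)"
        have e: "cis (\<phi> x) = e * e" "e * cnj e = 1"
          by (simp_all add: e_def cis_mult cis_cnj)
        have "\<Theta> (of_real x) - cnj u * H (of_real x) = e * e * (1 - cnj u * cnj e * of_real (g x))"
          using e(2) by (simp add: \<Theta>_real H_real e(1) flip: e_def) algebra
        also have "\<dots> = e * e * cnj (1 - u * H (of_real x))"
          by (simp add: H_real e_def)
        finally have "cmod (\<Theta> (of_real x) - cnj u * H (of_real x)) = cmod (1 - u * H (of_real x))"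
          by (simp add: norm_mult e_def del: complex_cnj_diff complex_cnj_mult)
        then show ?thesis
          using den0[of "of_real x"] by (simp add: norm_divide)
      qed
    qed (use z in simp)
    then show ?thesis
      using den0[OF z] by (simp add: norm_divide divide_le_eq)
  qed
  have dH': "(H has_field_derivative deriv H (of_real x0)) (at (of_real x0))"
    by (rule field_differentiable_derivI[OF dH]) simp
  have d\<Theta>': "(\<Theta> has_field_derivative deriv \<Theta> (of_real x0)) (at (of_real x0))"
    by (rule field_differentiable_derivI[OF d\<Theta>]) simp
  have dcis: "((\<lambda>x. cis (r * \<phi> x)) has_vector_derivative (r * \<phi>') *\<^sub>R (\<i> * cis (r * \<phi> x0))) (at x0)" for r
    by (intro cis_has_vector_derivative DERIV_cmult d\<phi>)
  \<comment> \<open>Nothing is assumed about the smoothness of \<open>g\<close>; it is recovered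
    from \<open>H\<close> and \<open>\<phi>\<close>, which are differentiable.\<close>
  have g_eq: "g x = Re (H (of_real x) * cis (- 1 / 2 * \<phi> x))" for x
  proof -
    have "H (of_real x) * cis (- 1 / 2 * \<phi> x) = cis (\<phi> x / 2) * cis (- 1 / 2 * \<phi> x) * of_real (g x)"
      by (simp add: H_real)
    also have "\<dots> = of_real (g x)"
      by (simp add: cis_mult)
    finally show ?thesis
      by simp
  qed
  have "\<exists>g'. ((\<lambda>x. Re (H (of_real x) * cis (- 1 / 2 * \<phi> x))) has_vector_derivative g') (at x0)"
    by (rule exI, rule bounded_linear.has_vector_derivative[OF bounded_linear_Re
        has_vector_derivative_mult[OF real_line_has_vector_derivative[OF dH'] dcis]])
  then obtain g' where dg: "(g has_real_derivative g') (at x0)"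
    unfolding g_eq[symmetric] has_real_derivative_iff_has_vector_derivative by blast
  have Th': "deriv \<Theta> (of_real x0) = \<i> * \<phi>' * (c * c)"
  proof -
    have "((\<lambda>x. cis (1 * \<phi> x)) has_vector_derivative deriv \<Theta> (of_real x0)) (at x0)"
      using real_line_has_vector_derivative[OF d\<Theta>'] by (simp add: \<Theta>_real)
    from vector_derivative_unique_at[OF this dcis] show ?thesis
      by (simp add: c_def cis_mult scaleR_conv_of_real mult_ac)
  qed
  have H': "deriv H (of_real x0) = c * Complex g' (\<phi>' / 2 * \<gamma>)"
  proof -
    have 1: "((\<lambda>x. cis (1/2 * \<phi> x) * of_real (g x)) has_vector_derivative deriv H (of_real x0)) (at x0)"
      using real_line_has_vector_derivative[OF dH'] by (simp add: H_real)
    have "((\<lambda>x. complex_of_real (g x)) has_vector_derivative of_real g') (at x0)"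
      using dg by (auto intro!: derivative_eq_intros simp: has_real_derivative_iff_has_vector_derivative)
    from vector_derivative_unique_at[OF 1 has_vector_derivative_mult[OF dcis this]] show ?thesis
      by (simp add: c_def \<gamma>_def scaleR_conv_of_real Complex_eq algebra_simps)
  qed
  have key: "0 \<le> \<phi>' / 2 * s + \<sigma> * g'" if \<sigma>: "\<sigma> \<in> {1, - 1}" for \<sigma> :: real
  proof -
    define v where "v = Complex \<gamma> (\<sigma> * s)"
    define u where "u = v * cnj c"
    have cc: "c * cnj c = 1" "cmod c = 1"
      by (simp_all add: c_def cis_mult cis_cnj)
    have "(cmod v)\<^sup>2 = 1"
      using \<sigma> s by (auto simp: v_def cmod_power2)
    then have u1: "cmod u = 1"
      using norm_ge_zero[of v] by (simp add: u_def norm_mult cc power2_eq_1_iff)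
    define N where "N = (\<lambda>t::real. (cmod (1 - u * H (of_real x0 + \<i> * of_real t)))\<^sup>2
        - (cmod (\<Theta> (of_real x0 + \<i> * of_real t) - cnj u * H (of_real x0 + \<i> * of_real t)))\<^sup>2)"
    define D where "D = - 2 * Im (cnj (1 - u * H (of_real x0)) * (0 - u * deriv H (of_real x0)))
       - (- 2 * Im (cnj (\<Theta> (of_real x0) - cnj u * H (of_real x0)) * (deriv \<Theta> (of_real x0) - cnj u * deriv H (of_real x0))))"
    have "(N has_real_derivative D) (at 0)"
      unfolding N_def D_def
      by (intro DERIV_diff DERIV_norm_square_vertical DERIV_const DERIV_cmult dH' d\<Theta>')
    have Hx: "H (of_real x0) = c * of_real \<gamma>" and Tx: "\<Theta> (of_real x0) = c * c"
      by (simp_all add: H_real \<Theta>_real c_def \<gamma>_def cis_mult)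
    have uH: "u * H (of_real x0) = v * of_real \<gamma>" "u * deriv H (of_real x0) = v * Complex g' (\<phi>' / 2 * \<gamma>)"
      using cc(1) unfolding Hx H' u_def by algebra+
    have TH: "\<Theta> (of_real x0) - cnj u * H (of_real x0) = c * c * (1 - cnj v * of_real \<gamma>)"
      by (simp add: Hx Tx u_def algebra_simps)
    have TH': "deriv \<Theta> (of_real x0) - cnj u * deriv H (of_real x0)
        = c * c * (\<i> * \<phi>' - cnj v * Complex g' (\<phi>' / 2 * \<gamma>))"
      by (simp add: H' Th' u_def algebra_simps)
    have prod: "cnj (c * c * a) * (c * c * b) = cnj a * b" for a b
    proof -
      have "cnj (c * c * a) * (c * c * b) = (c * cnj c) * (c * cnj c) * (cnj a * b)"
        by (simp add: mult_ac)
      then show ?thesis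
        by (simp add: cc)
    qed
    define Q where "Q = \<phi>' / 2"
    have Q: "\<phi>' = 2 * Q"
      by (simp add: Q_def)
    have "N 0 = 0"
      unfolding N_def using TH uH(1) by (simp add: norm_mult cc) (metis complex_cnj_complex_of_real complex_cnj_diff complex_cnj_mult complex_cnj_one complex_mod_cnj)
    moreover have "0 \<le> N t" if "0 \<le> t" for t
      using ineq[OF u1, of "of_real x0 + \<i> * of_real t"] that by (simp add: N_def power_mono)
    ultimately have "0 \<le> D"
      using DERIV_nonneg_at_right_minimum[OF \<open>(N has_real_derivative D) (at 0)\<close>] by simp
    \<comment> \<open>The unimodular factors \<open>c\<close> have cancelled. As
      \<open>1 - \<gamma> * \<gamma> = s * s\<close>, the positive factor \<open>4 * s\<close>
      splits off and leaves the desired sign condition.\<close>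
    also have "D = 4 * Q * (1 - \<gamma> * \<gamma>) + 4 * s * (\<sigma> * g')"
      unfolding D_def TH TH' uH prod Q
      using \<sigma> s(2) by (auto simp: v_def power2_eq_square) (simp_all add: algebra_simps)
    also have "\<dots> = 4 * s * (\<phi>' / 2 * s + \<sigma> * g')"
    proof -
      have "1 - \<gamma> * \<gamma> = s * s"
        using s(2) by (simp add: power2_eq_square)
      then have "4 * Q * (1 - \<gamma> * \<gamma>) = 4 * s * (\<phi>' / 2 * s)"
        by (simp only:) (simp add: Q)
      then show ?thesis
        by (simp only: distrib_left)
    qed
    finally show ?thesis
      using s(1) by (simp add: zero_le_mult_iff)
  qed
  have "\<bar>g'\<bar> \<le> \<phi>' / 2 * sqrt (1 - (g x0)\<^sup>2)"
    using key[of 1] key[of "- 1"] by (auto simp: s_def \<gamma>_def)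
  with dg show ?thesis
    by blast
qed


section \<open>Boundedness of functions in the Hardy-type space\<close>

lemma sharp_holomorphic: "f holomorphic_on UNIV \<Longrightarrow> sharp f holomorphic_on UNIV"
  using holomorphic_on_compose_cnj_cnj[of f UNIV]
  by (simp add: sharp_def[abs_def] o_def holomorphic_on_subset)

lemma sharp_sharp [simp]: "sharp (sharp f) = f"
  by (simp add: sharp_def fun_eq_iff)

lemma sharp_of_real [simp]: "sharp f (of_real x) = cnj (f (of_real x))"
  by (simp add: sharp_def)

lemma sharp_mem_HpE: "f \<in> HpE p E \<Longrightarrow> sharp f \<in> HpE p E"
  by (simp add: HpE_def sharp_holomorphic)

lemma integral_interval_le_lebesgue:
  fixes w :: "real \<Rightarrow> real"
  assumes "integrable lborel w" "\<And>x. 0 \<le> w x"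
  shows "integral {a..b} w \<le> (\<integral>x. w x \<partial>lborel)" "w integrable_on {a..b}"
proof -
  have UN: "w integrable_on UNIV"
    using assms(1) by (rule integrable_on_lborel)
  then show ab: "w integrable_on {a..b}"
    by (rule integrable_on_subinterval[of w UNIV a b, simplified])
  show "integral {a..b} w \<le> (\<integral>x. w x \<partial>lborel)"
    using integral_subset_le[OF _ ab UN] assms integral_lborel[OF assms(1)] by simp
qed

section \<open>The inner function of E, a zero-free strip and the resulting bound on f/E\<close>

locale hermite_biehler_phase =
  fixes E :: "complex \<Rightarrow> complex" and \<phi> :: "real \<Rightarrow> real" and L :: real
  assumes hb: "hermite_biehler E"
    and E_real_nz: "\<And>x::real. E (of_real x) \<noteq> 0"
    and phase: "phase_function E \<phi>"
    and deriv_le: "\<And>x. \<bar>deriv \<phi> x\<bar> \<le> L"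
begin

definition \<Theta> :: "complex \<Rightarrow> complex" where "\<Theta> z = sharp E z / E z"

lemma E_holomorphic: "E holomorphic_on UNIV"
  using hb by (simp add: hermite_biehler_def)

lemma E_nz: "E z \<noteq> 0" if "0 \<le> Im z"
proof (cases "0 < Im z")
  case True
  then have "cmod (E (cnj z)) < cmod (E z)"
    using hb by (simp add: hermite_biehler_def)
  then show ?thesis
    by auto
next
  case False
  then have "z = of_real (Re z)"
    using that by (simp add: complex_eq_iff)
  then show ?thesis
    using E_real_nz by metis
qed

lemma quotient_field_differentiable:
  assumes "f holomorphic_on UNIV" "E z \<noteq> 0"
  shows "(\<lambda>z. f z / E z) field_differentiable at z"
  using assms E_holomorphic
  by (intro field_differentiable_divide) (auto simp: holomorphic_on_def)

lemma \<Theta>_field_differentiable: "0 \<le> Im z \<Longrightarrow> \<Theta> field_differentiable at z"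
  unfolding \<Theta>_def[abs_def]
  by (intro quotient_field_differentiable sharp_holomorphic E_holomorphic E_nz)

lemma \<Theta>_less_1: "0 < Im z \<Longrightarrow> cmod (\<Theta> z) < 1"
  using hb E_nz[of z] by (simp add: \<Theta>_def sharp_def hermite_biehler_def norm_divide)

lemma \<Theta>_of_real: "\<Theta> (of_real x) = cis (\<phi> x)"
  using phase unfolding phase_function_def \<Theta>_def by (simp add: cis_conv_exp)

lemma phase_DERIV: "(\<phi> has_real_derivative deriv \<phi> x) (at x)"
proof -
  have "((deriv ^^ 0) \<phi>) differentiable (at x)"
    using phase unfolding phase_function_def smooth_real_def by blast
  then show ?thesis
    using DERIV_deriv_iff_real_differentiable by auto
qed

lemma phase_lipschitz: "\<bar>\<phi> x - \<phi> y\<bar> \<le> L * \<bar>x - y\<bar>"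
  using field_differentiable_bound[of UNIV \<phi> "deriv \<phi>" L x y] phase_DERIV deriv_le by simp

lemma \<Theta>_lower_bound: "0 \<le> Im z \<Longrightarrow> 1 - L * Im z \<le> cmod (\<Theta> z)"
proof (rule inner_function_lower_bound)
  show "cmod (\<Theta> (of_real x) - \<Theta> (of_real y)) \<le> L * \<bar>x - y\<bar>" for x y
    using norm_cis_diff_le[of "\<phi> x" "\<phi> y"] phase_lipschitz[of x y] by (simp add: \<Theta>_of_real)
qed (auto simp: \<Theta>_of_real \<Theta>_field_differentiable less_imp_le[OF \<Theta>_less_1])

text \<open>The strictness in the Hermite--Biehler condition enters: \<open>L \<le> 0\<close> would
  force the modulus of \<open>\<Theta>\<close> at \<open>\<i>\<close> to be at least 1.\<close>

lemma L_pos: "0 < L"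
  using \<Theta>_lower_bound[of \<i>] \<Theta>_less_1[of \<i>] by simp

text \<open>At height at most \<open>1 / (2 * L)\<close> the modulus of \<open>\<Theta>\<close> is
  at least 1/2. Read at the reflected point \<open>cnj z\<close>, this compares \<open>E\<close>
  below the line with its nonzero values above.\<close>

lemma E_nz_strip: "E z \<noteq> 0 \<and> cmod (E (cnj z)) \<le> 2 * cmod (E z)"
  if "Im z \<le> 0" "- (1 / (2 * L)) \<le> Im z"
proof -
  have "L * - Im z \<le> L * (1 / (2 * L))"
    using that L_pos by (intro mult_left_mono) auto
  then have "1 / 2 \<le> cmod (\<Theta> (cnj z))"
    using \<Theta>_lower_bound[of "cnj z"] that L_pos by simp
  moreover have nz: "E (cnj z) \<noteq> 0"
    using that by (intro E_nz) auto
  ultimately have "cmod (E (cnj z)) \<le> 2 * cmod (E z)"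
    by (simp add: \<Theta>_def norm_divide sharp_def field_simps)
  then show ?thesis
    using nz by (auto simp: sharp_def)
qed

text \<open>Squares of half-side \<open>R\<close> around points of the closed half-plane stay in the
  region where \<open>E\<close> has no zeros. The means of \<open>f/E\<close> on horizontal lines
  are bounded by the Hardy condition above the real line, by that for \<open>sharp f / E\<close> at
  the reflected point below it, and by continuity on it. The local bound by means then gives a bound
  independent of the point.\<close>

lemma HpE_bounded:
  assumes f: "f \<in> HpE p E" and p: "0 < p"
  obtains B where "\<And>z. 0 \<le> Im z \<Longrightarrow> cmod (f z / E z) \<le> B"
proof -
  define h where "h = (\<lambda>z. f z / E z)"
  define R where "R = 1 / (2 * L)"
  \<comment> \<open>The local bound requires an exponent at most 1;
    \<open>t powr q \<le> 1 + t powr p\<close> leads from \<open>p\<close> to \<open>q\<close> and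
    adds the interval length \<open>2 * R\<close> to \<open>M\<close>.\<close>
  define q where "q = min p 1"
  have q: "0 < q" "q \<le> 1" "q \<le> p"
    using p by (auto simp: q_def)
  have R: "0 < R"
    using L_pos by (simp add: R_def)
  have fhol: "f holomorphic_on UNIV"
    using f by (simp add: HpE_def)
  obtain M1 where M1: "\<And>y. 0 < y \<Longrightarrow> integrable lborel (\<lambda>x. cmod (h (Complex x y)) powr p)"
      "\<And>y. 0 < y \<Longrightarrow> (\<integral>x. cmod (h (Complex x y)) powr p \<partial>lborel) \<le> M1"
    using f by (auto simp: HpE_def hardy_def h_def)
  define k where "k = (\<lambda>z. sharp f z / E z)"
  obtain M2 where M2: "\<And>y. 0 < y \<Longrightarrow> integrable lborel (\<lambda>x. cmod (k (Complex x y)) powr p)"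
      "\<And>y. 0 < y \<Longrightarrow> (\<integral>x. cmod (k (Complex x y)) powr p \<partial>lborel) \<le> M2"
    using f by (auto simp: HpE_def hardy_def k_def)
  define M where "M = 2 * R + max M1 (2 powr p * M2)"
  have E_nz': "E z \<noteq> 0" if "- R \<le> Im z" for z
    using that E_nz[of z] E_nz_strip[of z] by (cases "0 \<le> Im z") (auto simp: R_def)
  have dh: "h field_differentiable at z" if "- R \<le> Im z" for z
    unfolding h_def by (intro quotient_field_differentiable fhol E_nz' that)
  have conth: "continuous_on {z. - R \<le> Im z} h"
    by (auto intro!: continuous_at_imp_continuous_on field_differentiable_imp_continuous_at dh)
  have cont_line: "continuous_on {a..b} (\<lambda>x. cmod (h (Complex x y)) powr q)" if "- R \<le> y" for a b y
    using q that
    by (intro continuous_on_powr' continuous_intros continuous_on_compose2[OF conth])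
       (auto intro!: continuous_intros simp: Complex_eq)
  have powr_le: "t powr q \<le> 1 + t powr p" if "0 \<le> t" for t :: real
  proof (cases "t \<le> 1")
    case True
    then have "t powr q \<le> 1 powr q"
      using that q by (intro powr_mono2) auto
    then show ?thesis
      using powr_ge_zero[of t p] by (simp add: add_increasing2)
  next
    case False
    then have "t powr q \<le> t powr p"
      using q by (intro powr_mono) auto
    then show ?thesis
      by simp
  qed
  have from_p: "integral {x0 - R..x0 + R} (\<lambda>x. cmod (h (Complex x y)) powr q) \<le> M"
    if "- R \<le> y" and w: "integrable lborel w" "\<And>x. cmod (h (Complex x y)) powr p \<le> w x"
      "(\<integral>x. w x \<partial>lborel) \<le> max M1 (2 powr p * M2)" for x0 y w
  proof -
    have w0: "0 \<le> w x" for x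
      using w(2)[of x] powr_ge_zero order_trans by blast
    note wint = integral_interval_le_lebesgue[OF w(1) w0]
    have "integral {x0 - R..x0 + R} (\<lambda>x. cmod (h (Complex x y)) powr q)
        \<le> integral {x0 - R..x0 + R} (\<lambda>x. 1 + w x)"
    proof (rule integral_le)
      show "(\<lambda>x. cmod (h (Complex x y)) powr q) integrable_on {x0 - R..x0 + R}"
        by (intro integrable_continuous_real cont_line that)
      show "(\<lambda>x. 1 + w x) integrable_on {x0 - R..x0 + R}"
        by (intro integrable_add wint(2)) auto
      show "cmod (h (Complex x y)) powr q \<le> 1 + w x" for x
        using powr_le[of "cmod (h (Complex x y))"] w(2)[of x] by simp
    qed
    also have "\<dots> = 2 * R + integral {x0 - R..x0 + R} w"
      using R by (subst integral_add) (auto intro: wint(2))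
    also have "\<dots> \<le> M"
      using wint(1)[of "x0 - R" "x0 + R"] w(3) by (simp add: M_def)
    finally show ?thesis .
  qed
  have pos: "integral {x0 - R..x0 + R} (\<lambda>x. cmod (h (Complex x y)) powr q) \<le> M" if "0 < y" for x0 y
    using that R M1(2)[OF that] by (intro from_p[OF _ M1(1)[OF that]]) auto
  have neg: "integral {x0 - R..x0 + R} (\<lambda>x. cmod (h (Complex x y)) powr q) \<le> M"
    if y: "- R \<le> y" "y < 0" for x0 y
  proof (rule from_p[OF y(1)])
    show "integrable lborel (\<lambda>x. 2 powr p * cmod (k (Complex x (- y))) powr p)"
      using M2(1)[of "- y"] y by simp
    show "cmod (h (Complex x y)) powr p \<le> 2 powr p * cmod (k (Complex x (- y))) powr p" for x
    proof -
      define z where "z = Complex x y"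
      have z: "E z \<noteq> 0" "cmod (E (cnj z)) \<le> 2 * cmod (E z)" "cnj z = Complex x (- y)"
        using E_nz_strip[of z] y by (auto simp: z_def R_def complex_eq_iff)
      have "E (cnj z) \<noteq> 0"
        using y by (intro E_nz) (auto simp: z_def)
      then have "cmod (h z) \<le> 2 * cmod (k (cnj z))"
        using z(1) mult_left_mono[OF z(2), of "cmod (f z)"]
        by (simp add: h_def k_def sharp_def norm_divide field_simps)
      then have "cmod (h z) powr p \<le> (2 * cmod (k (cnj z))) powr p"
        using p by (intro powr_mono2) auto
      then show ?thesis
        using z(3) by (simp add: powr_mult z_def)
    qed
    show "(\<integral>x. 2 powr p * cmod (k (Complex x (- y))) powr p \<partial>lborel) \<le> max M1 (2 powr p * M2)"
      using M2(2)[of "- y"] y by (simp add: max.coboundedI2)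
  qed
  \<comment> \<open>The Hardy condition concerns positive heights only, so the real line is reached
    as a limit from above.\<close>
  have zero: "integral {x0 - R..x0 + R} (\<lambda>x. cmod (h (Complex x 0)) powr q) \<le> M" for x0
  proof -
    define I where "I = (\<lambda>y. integral (cbox (x0 - R) (x0 + R)) (\<lambda>x. cmod (h (Complex x y)) powr q))"
    have "continuous_on {0..1} I"
      unfolding I_def
    proof (rule integral_continuous_on_param)
      show "continuous_on ({0..1} \<times> cbox (x0 - R) (x0 + R)) (\<lambda>(y, x). cmod (h (Complex x y)) powr q)"
        unfolding case_prod_beta using q R
        by (intro continuous_on_powr' continuous_intros continuous_on_compose2[OF conth])
           (auto intro!: continuous_intros simp: Complex_eq)
    qed
    then have "(I \<longlongrightarrow> I 0) (at_right 0)"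
      unfolding continuous_on_def using at_within_Icc_at_right[of 0 "1::real"] by force
    moreover have "\<forall>\<^sub>F y in at_right 0. I y \<le> M"
      using eventually_at_right_less by eventually_elim (simp add: I_def pos)
    ultimately have "I 0 \<le> M"
      by (rule tendsto_upperbound) simp
    then show ?thesis
      by (simp add: I_def)
  qed
  have bound: "cmod (h z) powr q \<le> 16 * M * 4 powr (1 / q) / (pi\<^sup>2 * R)" if z: "0 \<le> Im z" for z
  proof -
    have "cmod (h (Complex (Re z) (Im z))) powr q \<le> 16 * M * 4 powr (1 / q) / (pi\<^sup>2 * R)"
    proof (rule holomorphic_bound_of_line_integrals[OF q(1,2) R])
      show "h holomorphic_on cbox (Complex (Re z - R) (Im z - R)) (Complex (Re z + R) (Im z + R))"
        unfolding holomorphic_on_def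
        using z by (auto intro!: field_differentiable_at_within dh simp: in_cbox_complex_iff)
      fix y assume "\<bar>y - Im z\<bar> \<le> R"
      then have "- R \<le> y"
        using z by linarith
      then show "integral {Re z - R..Re z + R} (\<lambda>x. cmod (h (Complex x y)) powr q) \<le> M"
        using pos neg zero by (cases y "0 :: real" rule: linorder_cases) auto
    qed
    then show ?thesis
      by simp
  qed
  show ?thesis
  proof (rule that)
    fix z :: complex
    assume "0 \<le> Im z"
    then have "(cmod (h z) powr q) powr (1 / q) \<le> (16 * M * 4 powr (1 / q) / (pi\<^sup>2 * R)) powr (1 / q)"
      using q bound by (intro powr_mono2) auto
    then show "cmod (f z / E z) \<le> (16 * M * 4 powr (1 / q) / (pi\<^sup>2 * R)) powr (1 / q)"
      using q by (simp add: powr_powr h_def)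
  qed
qed

end


section \<open>Comparison with the cosine\<close>

context hermite_biehler_phase
begin

text \<open>The symmetrized function has a real part \<open>g\<close> that agrees with
  \<open>cmod (f / E) / S1\<close> at \<open>x0\<close>, and \<open>arccos g\<close> is Lipschitz
  with constant \<open>L / 2\<close>. Since cosine decreases on \<open>{0..pi}\<close>, this bounds
  \<open>g\<close>, hence the modulus, from below.\<close>

lemma cosine_comparison:
  assumes f: "f \<in> HpE p E" and p: "0 < p"
    and S: "\<And>x::real. cmod (f (of_real x) / E (of_real x)) \<le> S" "S < S1"
    and \<theta>0: "\<theta>0 = arccos (cmod (f (of_real x0) / E (of_real x0)) / S1)"
    and x: "\<theta>0 + L / 2 * \<bar>x - x0\<bar> \<le> pi"
  shows "S1 * cos (\<theta>0 + L / 2 * \<bar>x - x0\<bar>) \<le> cmod (f (of_real x) / E (of_real x))"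
proof -
  define h where "h = (\<lambda>z. f z / E z)"
  define e where "e = (\<lambda>x. cis (\<phi> x / 2))"
  have S0: "0 \<le> S"
    using S(1)[of 0] norm_ge_zero order_trans by blast
  have S1: "0 < S1"
    using S0 S(2) by linarith
  obtain B1 where B1: "\<And>z. 0 \<le> Im z \<Longrightarrow> cmod (f z / E z) \<le> B1"
    using HpE_bounded[OF f p] by blast
  obtain B2 where B2: "\<And>z. 0 \<le> Im z \<Longrightarrow> cmod (sharp f z / E z) \<le> B2"
    using HpE_bounded[OF sharp_mem_HpE[OF f] p] by blast
  have fhol: "f holomorphic_on UNIV"
    using f by (simp add: HpE_def)
  \<comment> \<open>The rotation \<open>c\<close> makes the symmetrized function lose no modulus at
    \<open>x0\<close>.\<close>
  obtain c where c: "cmod c = 1" "c * (h (of_real x0) * cnj (e x0)) = of_real (cmod (h (of_real x0)))"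
  proof -
    define w where "w = h (of_real x0) * cnj (e x0)"
    have w: "cmod w = cmod (h (of_real x0))"
      by (simp add: w_def norm_mult e_def)
    show ?thesis
    proof (cases "w = 0")
      case True
      then show ?thesis
        using that[of 1] w by (auto simp: w_def)
    next
      case False
      then have "cnj (sgn w) * w = of_real (cmod w)"
        by (simp add: sgn_div_norm scaleR_conv_of_real mult_ac complex_norm_square[symmetric] power2_eq_square divide_simps)
      then show ?thesis
        using that[of "cnj (sgn w)"] w False by (simp add: w_def norm_sgn)
    qed
  qed
  \<comment> \<open>Dividing by \<open>S1\<close> rather than \<open>S\<close> yields the bound
    \<open>S / S1 < 1\<close> that the Bernstein--Szego inequality demands.\<close>
  define H where "H = (\<lambda>z. (c * (f z / E z) + cnj c * (sharp f z / E z)) / of_real (2 * S1))"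
  define g where "g = (\<lambda>x. Re (c * (h (of_real x) * cnj (e x))) / S1)"
  have g_h: "S1 * \<bar>g x\<bar> \<le> cmod (h (of_real x))" for x
  proof -
    have "S1 * \<bar>g x\<bar> = \<bar>Re (c * (h (of_real x) * cnj (e x)))\<bar>"
      using S1 by (simp add: g_def)
    also have "\<dots> \<le> cmod (c * (h (of_real x) * cnj (e x)))"
      by (rule abs_Re_le_cmod)
    also have "\<dots> = cmod (h (of_real x))"
      by (simp add: norm_mult c e_def)
    finally show ?thesis .
  qed
  have g_le: "\<bar>g x\<bar> \<le> S / S1" for x
    using g_h[of x] S(1)[of x] S1 by (simp add: h_def pos_le_divide_eq mult.commute)
  \<comment> \<open>On the line \<open>sharp f / E\<close> is \<open>cnj h * \<Theta>\<close> and
    \<open>\<Theta> = e * e\<close>, so the numerator of \<open>H\<close> is \<open>e\<close> times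
    twice a real part.\<close>
  have H_real: "H (of_real x) = cis (\<phi> x / 2) * of_real (g x)" for x
  proof -
    define w where "w = c * h (of_real x)"
    have ee: "e x * cnj (e x) = 1" "cis (\<phi> x) = e x * e x"
      by (simp_all add: e_def cis_mult cis_cnj)
    have shf: "sharp f (of_real x) / E (of_real x) = cnj (h (of_real x)) * \<Theta> (of_real x)"
      using E_real_nz[of x] by (simp add: h_def \<Theta>_def)
    have "H (of_real x) * of_real (2 * S1) = w + cnj c * (sharp f (of_real x) / E (of_real x))"
      using S1 by (simp add: H_def w_def h_def del: sharp_of_real)
    also have "\<dots> = w + cnj w * (e x * e x)"
      unfolding shf by (simp add: \<Theta>_of_real ee w_def)
    also have "\<dots> = e x * (w * cnj (e x) + cnj (w * cnj (e x)))"
      using ee(1) by (simp add: algebra_simps)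
    also have "w * cnj (e x) + cnj (w * cnj (e x)) = of_real (2 * Re (w * cnj (e x)))"
      by (rule complex_add_cnj)
    also have "Re (w * cnj (e x)) = S1 * g x"
      using S1 by (simp add: g_def w_def mult.assoc)
    finally show ?thesis
      using S1 by (simp add: e_def)
  qed
  have gder: "\<exists>g'. (g has_real_derivative g') (at x) \<and> \<bar>g'\<bar> \<le> deriv \<phi> x / 2 * sqrt (1 - (g x)\<^sup>2)" for x
  proof (rule bernstein_szego_half_plane[where \<Theta> = \<Theta> and H = H and k = "S / S1" and \<phi> = \<phi>])
    show "H field_differentiable at z" if "0 \<le> Im z" for z
    proof -
      have "(\<lambda>z. f z / E z) field_differentiable at z" "(\<lambda>z. sharp f z / E z) field_differentiable at z"
        using that fhol by (auto intro!: quotient_field_differentiable sharp_holomorphic E_nz)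
      then show ?thesis
        unfolding H_def using S1
        by (intro field_differentiable_divide[OF field_differentiable_add[OF
              field_differentiable_mult[OF field_differentiable_const] field_differentiable_mult[OF field_differentiable_const]]
              field_differentiable_const]) auto
    qed
    show "cmod (H z) \<le> (B1 + B2) / (2 * S1)" if "0 < Im z" for z
    proof -
      have "cmod (c * (f z / E z) + cnj c * (sharp f z / E z)) \<le> B1 + B2"
      proof (rule norm_triangle_le)
        show "cmod (c * (f z / E z)) + cmod (cnj c * (sharp f z / E z)) \<le> B1 + B2"
          using B1[of z] B2[of z] that by (simp add: norm_mult c del: times_divide_eq_right)
      qed
      then show ?thesis
        unfolding H_def norm_divide using S1 by (simp add: divide_right_mono)
    qed
    show "S / S1 < 1"
      using S S1 by simp
  qed (auto simp: \<Theta>_field_differentiable \<Theta>_of_real phase_DERIV H_real g_le less_imp_le[OF \<Theta>_less_1])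
  have g1: "- 1 < g x" "g x < 1" for x
    using g_le[of x] S S1 by (auto simp: abs_le_iff) (smt (verit) divide_less_eq_1_pos)+
  \<comment> \<open>The square root in the Bernstein--Szego bound cancels the one in the derivative
    of \<open>arccos\<close>.\<close>
  have "\<exists>d. ((\<lambda>x. arccos (g x)) has_real_derivative d) (at x) \<and> \<bar>d\<bar> \<le> L / 2" for x
  proof -
    obtain g' where g': "(g has_real_derivative g') (at x)" "\<bar>g'\<bar> \<le> deriv \<phi> x / 2 * sqrt (1 - (g x)\<^sup>2)"
      using gder by blast
    have "0 < sqrt (1 - (g x)\<^sup>2)"
      using g1[of x] by (simp add: abs_square_less_1)
    then have "\<bar>inverse (- sqrt (1 - (g x)\<^sup>2)) * g'\<bar> \<le> deriv \<phi> x / 2"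
      using g'(2) by (simp add: abs_mult field_simps)
    also have "\<dots> \<le> L / 2"
      using deriv_le[of x] by simp
    finally show ?thesis
      using DERIV_chain2[OF DERIV_arccos[OF g1] g'(1)] by blast
  qed
  then obtain d where d: "\<And>x. ((\<lambda>x. arccos (g x)) has_real_derivative d x) (at x)" "\<And>x. \<bar>d x\<bar> \<le> L / 2"
    by metis
  have "\<bar>arccos (g x) - arccos (g x0)\<bar> \<le> L / 2 * \<bar>x - x0\<bar>"
    using field_differentiable_bound[of UNIV "\<lambda>x. arccos (g x)" d "L / 2" x x0] d by simp
  moreover have "g x0 = cmod (h (of_real x0)) / S1"
    unfolding g_def c(2) by simp
  then have "arccos (g x0) = \<theta>0"
    by (simp add: \<theta>0 h_def)
  ultimately have "arccos (g x) \<le> \<theta>0 + L / 2 * \<bar>x - x0\<bar>"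
    by linarith
  then have "cos (\<theta>0 + L / 2 * \<bar>x - x0\<bar>) \<le> cos (arccos (g x))"
    using arccos_lbound[of "g x"] g1[of x] x by (intro cos_monotone_0_pi_le) auto
  also have "\<dots> = g x"
    using g1[of x] by simp
  finally have "S1 * cos (\<theta>0 + L / 2 * \<bar>x - x0\<bar>) \<le> S1 * g x"
    using S1 by simp
  also have "\<dots> \<le> S1 * \<bar>g x\<bar>"
    using S1 by simp
  finally show ?thesis
    using g_h[of x] by (simp add: h_def)
qed

end

section \<open>Integrals of powers of the cosine\<close>

lemma cos_powr_integrable: "0 < p \<Longrightarrow> - (pi / 2) \<le> a \<Longrightarrow> b \<le> pi / 2 \<Longrightarrow>
  (\<lambda>x::real. cos x powr p) integrable_on {a..b}"
  by (intro integrable_continuous_real continuous_on_powr' continuous_intros)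
     (auto intro: cos_ge_zero)

text \<open>The angle runs from \<open>\<theta>\<close> to \<open>pi / 2\<close> on either side of
  \<open>x0\<close> over a length \<open>b\<close>; substitution with slope \<open>a\<close> gives
  the same contribution from both sides.\<close>

lemma cos_powr_integral_le_lebesgue:
  fixes w :: "real \<Rightarrow> real"
  assumes w: "integrable lborel w" "\<And>x. 0 \<le> w x" and p: "0 < p" and a: "0 < a"
    and \<theta>: "0 \<le> \<theta>" "\<theta> \<le> pi / 2"
    and le: "\<And>x. \<theta> + a * \<bar>x - x0\<bar> \<le> pi / 2 \<Longrightarrow> cos (\<theta> + a * \<bar>x - x0\<bar>) powr p \<le> w x"
  shows "2 / a * integral {\<theta>..pi / 2} (\<lambda>x. cos x powr p) \<le> (\<integral>x. w x \<partial>lborel)"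
proof -
  define J where "J = integral {\<theta>..pi / 2} (\<lambda>x. cos x powr p)"
  define b where "b = (pi / 2 - \<theta>) / a"
  define v where "v = (\<lambda>x. cos (\<theta> + a * \<bar>x - x0\<bar>) powr p)"
  have b: "0 \<le> b" "a * b = pi / 2 - \<theta>"
    using a \<theta> by (simp_all add: b_def)
  have J: "((\<lambda>x. cos x powr p) has_integral J) {\<theta>..pi / 2}"
    unfolding J_def using cos_powr_integrable[OF p] \<theta> by (intro integrable_integral) auto
  have Ja: "J /\<^sub>R a ^ DIM(real) = J / a"
    by (simp add: divide_inverse)
  have R: "(v has_integral J / a) {x0..x0 + b}"
  proof (rule has_integral_eq)
    have "(\<theta> - (\<theta> - a * x0)) /\<^sub>R a = x0" "(pi / 2 - (\<theta> - a * x0)) /\<^sub>R a = x0 + b"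
      using a by (simp_all add: b_def field_simps)
    then show "((\<lambda>x. cos (a *\<^sub>R x + (\<theta> - a * x0)) powr p) has_integral J / a) {x0..x0 + b}"
      using has_integral_affinity'[of "\<lambda>x. cos x powr p" J \<theta> "pi / 2" a "\<theta> - a * x0", unfolded cbox_interval, OF J a]
      by (simp only: Ja)
    show "cos (a *\<^sub>R x + (\<theta> - a * x0)) powr p = v x" if "x \<in> {x0..x0 + b}" for x
      using that by (simp add: v_def algebra_simps)
  qed
  \<comment> \<open>Left of \<open>x0\<close> the angle decreases in \<open>x\<close>; its negative
    is affine with slope \<open>a\<close>, so the reflected integral is the one to substitute
    in.\<close>
  have "((\<lambda>x. cos (- x) powr p) has_integral J) {- (pi / 2)..- \<theta>}"
    using J by (subst has_integral_reflect_real)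
  then have J': "((\<lambda>x. cos x powr p) has_integral J) {- (pi / 2)..- \<theta>}"
    by (simp only: cos_minus)
  have L: "(v has_integral J / a) {x0 - b..x0}"
  proof (rule has_integral_eq)
    have "(- (pi / 2) - (- \<theta> - a * x0)) /\<^sub>R a = x0 - b" "(- \<theta> - (- \<theta> - a * x0)) /\<^sub>R a = x0"
      using a by (simp_all add: b_def field_simps)
    then show "((\<lambda>x. cos (a *\<^sub>R x + (- \<theta> - a * x0)) powr p) has_integral J / a) {x0 - b..x0}"
      using has_integral_affinity'[of "\<lambda>x. cos x powr p" J "- (pi / 2)" "- \<theta>" a "- \<theta> - a * x0", unfolded cbox_interval, OF J' a]
      by (simp only: Ja)
    show "cos (a *\<^sub>R x + (- \<theta> - a * x0)) powr p = v x" if "x \<in> {x0 - b..x0}" for x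
    proof -
      have "a *\<^sub>R x + (- \<theta> - a * x0) = - (\<theta> + a * \<bar>x - x0\<bar>)"
        using that by (simp add: algebra_simps)
      then show ?thesis
        by (simp only: cos_minus v_def)
    qed
  qed
  have V: "(v has_integral J / a + J / a) {x0 - b..x0 + b}"
    using b by (intro has_integral_combine[OF _ _ L R]) auto
  note wint = integral_interval_le_lebesgue[OF w, of "x0 - b" "x0 + b"]
  have "J / a + J / a \<le> integral {x0 - b..x0 + b} w"
  proof (rule has_integral_le[OF V integrable_integral[OF wint(2)]])
    fix x assume "x \<in> {x0 - b..x0 + b}"
    then have "a * \<bar>x - x0\<bar> \<le> a * b"
      using a by (intro mult_left_mono) auto
    then show "v x \<le> w x"
      unfolding v_def using b by (intro le) auto
  qed
  then show ?thesis
    using wint(1) by (simp add: J_def)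
qed

lemma Kconst_powr:
  assumes p: "0 < p"
  shows "Kconst p powr p = 2 * integral {0..pi / 2} (\<lambda>x. cos x powr p)"
    and "0 < integral {0..pi / 2} (\<lambda>x. cos x powr p)"
proof -
  define J where "J = integral {0..pi / 2} (\<lambda>x. cos x powr p)"
  have J: "((\<lambda>x. cos x powr p) has_integral J) {0..pi / 2}"
    unfolding J_def using cos_powr_integrable[OF p] by (intro integrable_integral) auto
  have "((\<lambda>x. cos (- x) powr p) has_integral J) {- (pi / 2)..- 0}"
    using J by (subst has_integral_reflect_real)
  then have "((\<lambda>x. cos x powr p) has_integral J) {- (pi / 2)..0}"
    by (simp only: cos_minus minus_zero)
  from has_integral_combine[OF _ _ this J]
  have "((\<lambda>x. cos x powr p) has_integral J + J) {- (pi / 2)..pi / 2}"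
    by simp
  then have "((\<lambda>x. \<bar>cos x\<bar> powr p) has_integral J + J) {- (pi / 2)..pi / 2}"
    by (rule has_integral_eq[rotated]) (auto simp: cos_ge_zero)
  then have K: "Kconst p = (2 * J) powr (1 / p)"
    by (simp add: Kconst_def integral_unique)
  \<comment> \<open>Cosine is at least 1/2 on \<open>{0..pi / 3}\<close>.\<close>
  have J0: "0 < J"
  proof -
    have "integral {0..pi / 3} (\<lambda>x. (1 / 2) powr p :: real) \<le> integral {0..pi / 3} (\<lambda>x. cos x powr p)"
    proof (rule integral_le)
      show "(\<lambda>x. cos x powr p) integrable_on {0..pi / 3}"
        using p by (intro cos_powr_integrable) auto
      fix x assume x: "x \<in> {0..pi / 3}"
      have "cos (pi / 3) \<le> cos x"
        using x by (intro cos_monotone_0_pi_le) auto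
      then show "(1 / 2) powr p \<le> cos x powr p"
        using p by (intro powr_mono2) (auto simp: cos_60)
    qed auto
    also have "\<dots> \<le> J"
      unfolding J_def using p by (intro integral_subset_le cos_powr_integrable) auto
    finally have "pi / 3 * (1 / 2) powr p \<le> J"
      by simp
    moreover have "0 < pi / 3 * (1 / 2) powr p"
      by simp
    ultimately show ?thesis
      by linarith
  qed
  show "0 < integral {0..pi / 2} (\<lambda>x. cos x powr p)"
    using J0 by (simp add: J_def)
  show "Kconst p powr p = 2 * integral {0..pi / 2} (\<lambda>x. cos x powr p)"
    using J0 p by (simp add: K powr_powr flip: J_def)
qed

text \<open>The integrand is at most 1, so starting at \<open>\<theta>\<close> loses at most
  \<open>\<theta>\<close>; the loss vanishes as the near-maximum improves.\<close>

lemma cos_powr_integral_tail: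
  assumes p: "0 < p" and \<theta>: "0 \<le> \<theta>" "\<theta> \<le> pi / 2"
  shows "integral {0..pi / 2} (\<lambda>x. cos x powr p) - \<theta> \<le> integral {\<theta>..pi / 2} (\<lambda>x. cos x powr p)"
proof -
  have "integral {0..\<theta>} (\<lambda>x. cos x powr p) \<le> integral {0..\<theta>} (\<lambda>x. 1)"
  proof (rule integral_le)
    show "(\<lambda>x. cos x powr p) integrable_on {0..\<theta>}"
      using p \<theta> by (intro cos_powr_integrable) auto
    fix x assume x: "x \<in> {0..\<theta>}"
    then have "cos x powr p \<le> 1 powr p"
      using p \<theta> by (intro powr_mono2 cos_ge_zero) auto
    then show "cos x powr p \<le> 1"
      by simp
  qed auto
  moreover have "integral {0..\<theta>} (\<lambda>x. cos x powr p) + integral {\<theta>..pi / 2} (\<lambda>x. cos x powr p)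
      = integral {0..pi / 2} (\<lambda>x. cos x powr p)"
    using p \<theta> by (intro Henstock_Kurzweil_Integration.integral_combine cos_powr_integrable) auto
  ultimately show ?thesis
    using \<theta> by simp
qed

section \<open>The sup norm estimate and the embedding constant\<close>

context hermite_biehler_phase
begin

text \<open>Integrating the cosine comparison around a near-maximum gives the bound with a loss of
  \<open>arccos t\<close>, where \<open>t < 1\<close> measures the quality of the near-maximum;
  letting \<open>t\<close> tend to 1 removes the loss. By symmetry \<open>4 * J\<close> is
  \<open>2 * Kconst p powr p\<close>.\<close>

lemma supnorm_powr_le:
  assumes f: "f \<in> HpE p E" and p: "0 < p"
    and int: "integrable lborel (\<lambda>x. cmod (f (of_real x) / E (of_real x)) powr p)"
  shows "supnormE E f powr p * (2 * Kconst p powr p) \<le>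
    L * (\<integral>x. cmod (f (of_real x) / E (of_real x)) powr p \<partial>lborel)"
    and "0 \<le> supnormE E f"
proof -
  define h where "h = (\<lambda>x::real. cmod (f (of_real x) / E (of_real x)))"
  define S where "S = supnormE E f"
  define I where "I = (\<integral>x. h x powr p \<partial>lborel)"
  define J where "J = integral {0..pi / 2} (\<lambda>x. cos x powr p)"
  obtain B where B: "\<And>z. 0 \<le> Im z \<Longrightarrow> cmod (f z / E z) \<le> B"
    using HpE_bounded[OF f p] by blast
  have bdd: "bdd_above (range h)"
    by (rule bdd_aboveI2[of _ _ B]) (use B in \<open>simp add: h_def\<close>)
  have S_eq: "S = (SUP x. h x)"
    by (simp add: S_def supnormE_def h_def)
  have hS: "h x \<le> S" for x
    unfolding S_eq using bdd by (intro cSUP_upper) auto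
  have S0: "0 \<le> S"
    using hS[of 0] norm_ge_zero order_trans unfolding h_def by blast
  then show "0 \<le> supnormE E f"
    by (simp add: S_def)
  have I0: "0 \<le> I"
    by (simp add: I_def)
  have "S powr p * (4 * J) \<le> L * I"
  proof (cases "S = 0")
    case True
    then show ?thesis
      using I0 L_pos by simp
  next
    case False
    then have S_pos: "0 < S"
      using S0 by simp
    have step: "S powr p * (4 * (J - arccos t)) \<le> L * I" if t: "0 < t" "t < 1" for t
    \<comment> \<open>When the loss exceeds \<open>J\<close> the left side is not positive;
      otherwise \<open>J - arccos t\<close> is positive and the products can be compared
      factorwise.\<close>
    proof (cases "J \<le> arccos t")
      case True
      then have "S powr p * (4 * (J - arccos t)) \<le> 0"
        by (intro mult_nonneg_nonpos) auto
      also have "0 \<le> L * I"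
        using I0 L_pos by simp
      finally show ?thesis .
    next
      case False
      \<comment> \<open>The ratio \<open>t\<close> is split evenly: one factor \<open>sqrt t\<close>
        makes \<open>S1\<close> exceed \<open>S\<close> strictly, the other allows
        \<open>h x0\<close> to fall short of the supremum.\<close>
      define S1 where "S1 = S / sqrt t"
      have sq: "0 < sqrt t" "sqrt t < 1" "sqrt t * sqrt t = t"
        using t by auto
      have S1: "S < S1"
        using sq S_pos by (simp add: S1_def field_simps)
      have "S * sqrt t < S"
        using sq S_pos by simp
      then obtain x0 where x0: "S * sqrt t < h x0"
        unfolding S_eq using less_cSUP_iff[OF _ bdd] by auto
      define \<theta> where "\<theta> = arccos (h x0 / S1)"
      have "S * t = S * sqrt t * sqrt t"
        using sq(3) by (simp add: mult.assoc)
      also have "\<dots> \<le> h x0 * sqrt t"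
        using x0 sq by (intro mult_right_mono) auto
      finally have t_le: "t \<le> h x0 / S1"
        using S_pos sq by (simp add: S1_def field_simps)
      have le1: "h x0 / S1 \<le> 1"
        using hS[of x0] S1 S_pos by simp
      have \<theta>: "0 \<le> \<theta>" "\<theta> \<le> pi / 2" "\<theta> \<le> arccos t"
        unfolding \<theta>_def using t_le le1 t
        by (intro arccos_lbound arccos_le_pi2 arccos_le_arccos; linarith)+
      have "2 / (L / 2) * integral {\<theta>..pi / 2} (\<lambda>x. cos x powr p)
          \<le> (\<integral>x. h x powr p / S1 powr p \<partial>lborel)"
      proof (rule cos_powr_integral_le_lebesgue[OF _ _ p _ \<theta>(1,2)])
        show "integrable lborel (\<lambda>x. h x powr p / S1 powr p)"
          using int by (simp add: h_def)
        fix x assume x: "\<theta> + L / 2 * \<bar>x - x0\<bar> \<le> pi / 2"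
        have "0 \<le> cos (\<theta> + L / 2 * \<bar>x - x0\<bar>)"
          using \<theta>(1) L_pos x by (intro cos_ge_zero) (auto intro: order_trans[of _ 0])
        moreover have "S1 * cos (\<theta> + L / 2 * \<bar>x - x0\<bar>) \<le> h x"
          unfolding h_def
        proof (rule cosine_comparison[OF f p _ S1])
          show "cmod (f (of_real x) / E (of_real x)) \<le> S" for x
            using hS[of x] by (simp add: h_def)
          show "\<theta> + L / 2 * \<bar>x - x0\<bar> \<le> pi"
            using x pi_gt_zero by linarith
        qed (simp add: \<theta>_def h_def)
        ultimately have "cos (\<theta> + L / 2 * \<bar>x - x0\<bar>) powr p \<le> (h x / S1) powr p"
          using p S1 S_pos by (intro powr_mono2) (auto simp: field_simps)
        then show "cos (\<theta> + L / 2 * \<bar>x - x0\<bar>) powr p \<le> h x powr p / S1 powr p"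
          using S1 S_pos by (simp add: powr_divide h_def)
      qed (use L_pos in auto)
      also have "\<dots> = I / S1 powr p"
        by (simp add: I_def)
      finally have "4 * integral {\<theta>..pi / 2} (\<lambda>x. cos x powr p) * S1 powr p \<le> L * I"
        using L_pos S1 S_pos by (simp add: field_simps)
      moreover have "4 * (J - arccos t) * S powr p \<le> 4 * integral {\<theta>..pi / 2} (\<lambda>x. cos x powr p) * S1 powr p"
        using cos_powr_integral_tail[OF p \<theta>(1,2)] \<theta>(3) False S1 S_pos p
        by (intro mult_mono powr_mono2) (auto simp: J_def)
      ultimately show ?thesis
        by (simp add: mult_ac)
    qed
    have "((\<lambda>t. S powr p * (4 * (J - arccos t))) \<longlongrightarrow> S powr p * (4 * (J - arccos 1))) (at_left 1)"
    proof (intro tendsto_intros)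
      \<comment> \<open>At the endpoint 1 continuity of \<open>arccos\<close> is available within
        \<open>{- 1..1}\<close>, hence the limit from the left.\<close>
      have "(arccos \<longlongrightarrow> arccos 1) (at 1 within {- 1..1})"
        using continuous_on_arccos' unfolding continuous_on_def by (rule bspec) simp
      then show "(arccos \<longlongrightarrow> arccos 1) (at_left 1)"
        using at_within_Icc_at_left[of "- 1" "1::real"] by simp
    qed
    moreover have "\<forall>\<^sub>F t in at_left 1. S powr p * (4 * (J - arccos t)) \<le> L * I"
    proof (rule eventually_mono[OF eventually_at_left_real[of 0 "1::real", OF zero_less_one]])
      fix t :: real
      assume "t \<in> {0<..<1}"
      then show "S powr p * (4 * (J - arccos t)) \<le> L * I"
        using step[of t] by (simp only: greaterThanLessThan_iff)
    qed
    ultimately have "S powr p * (4 * (J - arccos 1)) \<le> L * I"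
      by (rule tendsto_upperbound) simp
    then show ?thesis
      by simp
  qed
  then show "supnormE E f powr p * (2 * Kconst p powr p) \<le>
      L * (\<integral>x. cmod (f (of_real x) / E (of_real x)) powr p \<partial>lborel)"
    using Kconst_powr(1)[OF p] by (simp add: S_def I_def h_def J_def)
qed

end

theorem theorem6:
  fixes E :: "complex \<Rightarrow> complex" and \<phi> :: "real \<Rightarrow> real" and p :: real
  assumes "hermite_biehler E"
    and "\<forall>x::real. E (of_real x) \<noteq> 0"
    and "phase_function E \<phi>"
    and "bounded (range (deriv \<phi>))"
    and "0 < p"
  shows "embC p E \<le>
    ereal ((SUP x. \<bar>deriv \<phi> x\<bar>) powr (1 / p) / (2 powr (1 / p) * Kconst p))"
proof -
  define L where "L = (SUP x. \<bar>deriv \<phi> x\<bar>)"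
  have "bdd_above (range (\<lambda>x. \<bar>deriv \<phi> x\<bar>))"
    using assms(4) by (auto simp: bounded_iff bdd_above_def)
  then interpret hermite_biehler_phase E \<phi> L
    using assms by unfold_locales (auto simp: L_def intro: cSUP_upper)
  have K: "0 < Kconst p" "0 < 2 * Kconst p powr p"
    using Kconst_powr[OF \<open>0 < p\<close>] by (auto simp: Kconst_def zero_less_mult_iff)
  have "supnormE E f / pnormE p E f \<le> L powr (1 / p) / (2 powr (1 / p) * Kconst p)"
    if f: "f \<in> HpE p E" and nz: "pnormE p E f \<noteq> 0" for f
  proof -
    define I where "I = (\<integral>x. cmod (f (of_real x) / E (of_real x)) powr p \<partial>lborel)"
    have pn: "pnormE p E f = I powr (1 / p)"
      by (simp add: pnormE_def I_def)
    have "I \<noteq> 0"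
      using nz pn by auto
    \<comment> \<open>The integral of a non-integrable function is 0 by convention, so a nonzero
      \<open>I\<close> yields integrability on the real line, which the Hardy condition does not
      state.\<close>
    then have int: "integrable lborel (\<lambda>x. cmod (f (of_real x) / E (of_real x)) powr p)"
      unfolding I_def using not_integrable_integral_eq by blast
    have I: "0 < I"
      using \<open>I \<noteq> 0\<close> by (simp add: I_def order_less_le)
    note S = supnorm_powr_le[OF f \<open>0 < p\<close> int, folded I_def]
    have "supnormE E f powr p \<le> L * I / (2 * Kconst p powr p)"
      using S(1) K(2) by (simp add: pos_le_divide_eq)
    then have "(supnormE E f powr p) powr (1 / p) \<le> (L * I / (2 * Kconst p powr p)) powr (1 / p)"
      using \<open>0 < p\<close> by (intro powr_mono2) auto
    then have "supnormE E f \<le> L powr (1 / p) * I powr (1 / p) / (2 powr (1 / p) * Kconst p)"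
      using S(2) \<open>0 < p\<close> K(1) I L_pos by (simp add: powr_powr powr_mult powr_divide)
    then show ?thesis
      using I by (simp add: pn divide_le_eq mult_ac)
  qed
  \<comment> \<open>The set in \<open>embC\<close> also contains 0, so the bound must be
    nonnegative.\<close>
  moreover have "0 \<le> L powr (1 / p) / (2 powr (1 / p) * Kconst p)"
    using K(1) by simp
  ultimately show ?thesis
    unfolding embC_def by (intro Sup_least) (auto simp flip: L_def)
qed

end
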